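(* Fix $1\le p_0<q<q_0\le\infty$ and let $\mathbb B=(B_Q)_{Q\in\mathcal Q}$ satisfy conditions (b) and (c) below. Assume further that for all cubes $R\subset Q$, $A_RA_Qf(x)=A_Qf(x)$ for a.e. $x\in2R$, and that each $A_Q$ is local: $A_Qf=\chi_{2Q}\,A_Q(f\chi_{2Q})$ for every cube $Q$. Let $f\in L^{p_0}_{loc}(\mathbb R^n)$ and let $a$ be a functional such that for every cube $Q$, $$\Big(\fint_{2Q}|B_Qf|^{p_0}\,dx\Big)^{1/p_0}\le a(2Q).$$ If $a\in D_q$, then for every cube $Q$, $\|B_Qf\|_{L^{q,\infty},Q}\le C\,a(2Q)$, with $C$ independent of $Q$ and $f$.
   Context: Cubes $Q=\prod_i[a_i,a_i+\ell(Q))$; $\lambda Q$ is the concentric cube of sidelength $\lambda\ell(Q)$; $\mathcal Q$ is the set of all cubes; $\fint_Eg=|E|^{-1}\int_Eg$; $\|g\|_{L^{q,\infty},Q}=\sup_{t>0}t(|\{x\in Q:|g(x)|>t\}|/|Q|)^{1/q}$. A functional is a map $a:\mathcal Q\to[0,\infty)$. $\mathbb B=(B_Q)_{Q\in\mathcal Q}$ are linear operators defined on $L^{p_0}_{loc}(\mathbb R^n)$ and $A_Q=I-B_Q$. Condition (b): there is $C_{p_0}$ with $\|B_Qf\|_{L^{p_0}(\mathbb R^n)}\le C_{p_0}\|f\|_{L^{p_0}(\mathbb R^n)}$ for all cubes $Q$. Condition (c): there are $\alpha_k\ge0$, $k\ge2$, with $\sum_k2^{kn/p_0}\alpha_k<\infty$,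 such that for every cube $Q$, $(\fint_{2Q}|A_Q(f\chi_{4Q})|^{q_0})^{1/q_0}\le\alpha_2(\fint_{4Q}|f|^{p_0})^{1/p_0}$ and, for all $j\ge1$, $(\fint_{2^jQ}|A_Q(f\chi_{\mathbb R^n\setminus2^{j+1}Q})|^{q_0})^{1/q_0}\le\sum_{k\ge2}\alpha_{k+j}(\fint_{2^{k+j}Q}|f|^{p_0})^{1/p_0}$ (essential suprema when $q_0=\infty$). $a\in D_q$ means there is $C\ge1$ such that $\sum_ia(Q_i)^q|Q_i|\le C^qa(Q)^q|Q|$ for every cube $Q$ and every family of pairwise disjoint cubes $Q_i\subset Q$. *)

theory Defs
  imports "HOL-Analysis.Analysis"
begin

text \<open>A cube Q = prod_i [a_i, a_i + l) is represented by its corner a and sidelength l > 0.\<close>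
type_synonym 'n cube = "(real^'n) \<times> real"

definition is_cube :: "'n::finite cube \<Rightarrow> bool" where
  "is_cube Q \<longleftrightarrow> snd Q > 0"

definition cube_set :: "'n::finite cube \<Rightarrow> (real^'n) set" where
  "cube_set Q = {x. \<forall>i. fst Q $ i \<le> x $ i \<and> x $ i < fst Q $ i + snd Q}"

text \<open>lambda Q: the concentric cube of sidelength lambda * l(Q).\<close>
definition scale_cube :: "real \<Rightarrow> 'n::finite cube \<Rightarrow> 'n cube" where
  "scale_cube lam Q = ((\<chi> i. fst Q $ i + (1 - lam) * snd Q / 2), lam * snd Q)"

definition enn_root :: "real \<Rightarrow> ennreal \<Rightarrow> ennreal" where
  "enn_root p x = (if x = \<infinity> then \<infinity> else ennreal (enn2real x powr (1 / p)))"

definition Lp_loc :: "real \<Rightarrow> (real^'n::finite \<Rightarrow> real) set" where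
  "Lp_loc p = {f. f \<in> borel_measurable lebesgue \<and>
       (\<forall>K. compact K \<longrightarrow> (\<integral>\<^sup>+x\<in>K. ennreal (\<bar>f x\<bar> powr p) \<partial>lebesgue) < \<infinity>)}"

definition Lp_norm :: "real \<Rightarrow> (real^'n::finite \<Rightarrow> real) \<Rightarrow> ennreal" where
  "Lp_norm p f = enn_root p (\<integral>\<^sup>+x. ennreal (\<bar>f x\<bar> powr p) \<partial>lebesgue)"

definition Lp_avg :: "real \<Rightarrow> (real^'n::finite) set \<Rightarrow> (real^'n \<Rightarrow> real) \<Rightarrow> ennreal" where
  "Lp_avg p E g = enn_root p
     ((\<integral>\<^sup>+x\<in>E. ennreal (\<bar>g x\<bar> powr p) \<partial>lebesgue) / emeasure lebesgue E)"

definition esssup_on :: "(real^'n::finite) set \<Rightarrow> (real^'n \<Rightarrow> real) \<Rightarrow> ennreal" where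
  "esssup_on E g = Inf {t. AE x in lebesgue. x \<in> E \<longrightarrow> ennreal \<bar>g x\<bar> \<le> t}"

definition avg_norm :: "ennreal \<Rightarrow> (real^'n::finite) set \<Rightarrow> (real^'n \<Rightarrow> real) \<Rightarrow> ennreal" where
  "avg_norm q E g = (if q = \<infinity> then esssup_on E g else Lp_avg (enn2real q) E g)"

definition weak_norm :: "real \<Rightarrow> (real^'n::finite) set \<Rightarrow> (real^'n \<Rightarrow> real) \<Rightarrow> ennreal" where
  "weak_norm q E g = (SUP t\<in>{0<..}. ennreal t *
      enn_root q (emeasure lebesgue {x\<in>E. t < \<bar>g x\<bar>} / emeasure lebesgue E))"

definition A_op :: "('n::finite cube \<Rightarrow> (real^'n \<Rightarrow> real) \<Rightarrow> (real^'n \<Rightarrow> real))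
     \<Rightarrow> 'n cube \<Rightarrow> (real^'n \<Rightarrow> real) \<Rightarrow> (real^'n \<Rightarrow> real)" where
  "A_op B Q f = (\<lambda>x. f x - B Q f x)"

definition Dq_const :: "real \<Rightarrow> real \<Rightarrow> ('n::finite cube \<Rightarrow> real) \<Rightarrow> bool" where
  "Dq_const q C a \<longleftrightarrow> C \<ge> 1 \<and>
     (\<forall>Q F. is_cube Q \<longrightarrow> (\<forall>R\<in>F. is_cube R \<and> cube_set R \<subseteq> cube_set Q) \<longrightarrow>
        (\<forall>R\<in>F. \<forall>S\<in>F. R \<noteq> S \<longrightarrow> cube_set R \<inter> cube_set S = {}) \<longrightarrow>
        (\<Sum>\<^sub>\<infinity>R\<in>F. ennreal (a R powr q) * emeasure lebesgue (cube_set R))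
          \<le> ennreal (C powr q * a Q powr q) * emeasure lebesgue (cube_set Q))"

definition in_Dq :: "real \<Rightarrow> ('n::finite cube \<Rightarrow> real) \<Rightarrow> bool" where
  "in_Dq q a \<longleftrightarrow> (\<exists>C. Dq_const q C a)"

end

theory Submission
  imports Defs
begin

text \<open>
Put \<open>h = B\<^sub>Q f\<close>. For a cube \<open>R \<subseteq> Q\<close> the identity \<open>A\<^sub>R A\<^sub>Q f = A\<^sub>Q f\<close> on \<open>2R\<close> turns \<open>A\<^sub>R h\<close> into \<open>h - B\<^sub>R f\<close>
there, so \<open>h = u + v\<close> on \<open>2R\<close> with \<open>u = A\<^sub>R h\<close> and \<open>v = B\<^sub>R f\<close>. By locality and (c), the
\<open>q\<^sub>0\<close>-average of \<open>u\<close> over \<open>2R\<close> is controlled by the \<open>p\<^sub>0\<close>-average of \<open>h\<close> over \<open>2R\<close>; the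
\<open>p\<^sub>0\<close>-average of \<open>v\<close> is at most \<open>a(2R)\<close>.

Let \<open>\<Omega>\<^sub>t\<close> be the union of the dyadic subcubes \<open>R\<close> of \<open>Q\<close> with \<open>p\<^sub>0\<close>-average of \<open>h\<close> over \<open>2R\<close>
larger than \<open>t\<close>. Inside a maximal such \<open>R\<close>, a Vitali covering shows that \<open>\<Omega>\<close> at level \<open>K t\<close> has
relative measure at most a constant times \<open>K powr -q\<^sub>0 + (a(2R) / (K t)) powr p\<^sub>0\<close>. The maximal cubes
with \<open>a(2R) > \<gamma> t\<close> have, by a Vitali selection of disjoint doubles and \<open>D\<^sub>q\<close>, total measure at most a
constant times \<open>(\<gamma> t) powr -q * a(2Q) powr q * |Q|\<close>. Since \<open>p\<^sub>0 < q < q\<^sub>0\<close>, choosing \<open>K\<close> large and then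
\<open>\<gamma>\<close> small makes \<open>\<phi>(t) = t powr q * |\<Omega>\<^sub>t|\<close> satisfy \<open>\<phi>(K t) \<le> \<phi>(t) / 2 + const\<close>, which bounds \<open>\<phi>\<close>;
if \<open>q\<^sub>0 = \<infinity>\<close>, any finite exponent above \<open>q\<close> serves in its place.
Lebesgue differentiation along dyadic cubes compares \<open>|{|h| > t}|\<close> with \<open>|\<Omega>\<^sub>t|\<close>.
\<close>

section \<open>Cubes and a Vitali covering\<close>

lemma cube_set_measurable [measurable, simp]: "cube_set Q \<in> sets borel"
proof -
  have "cube_set Q = (\<Inter>i. {x. fst Q $ i \<le> x $ i} \<inter> {x. x $ i < fst Q $ i + snd Q})"
    by (auto simp: cube_set_def)
  also have "\<dots> \<in> sets borel"
    by (intro sets.countable_INT'' sets.Int borel_closed borel_open closed_Collect_le open_Collect_less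
        continuous_intros) auto
  finally show ?thesis .
qed

lemma cube_set_lebesgue [measurable, simp]: "cube_set Q \<in> sets lebesgue"
  by (simp add: sets_completionI_sets)

text \<open>The half-open cube lies between the open and the closed box with the same corners, and
  these have equal volume.\<close>

lemma emeasure_cube_set:
  fixes Q :: "'n::finite cube"
  assumes "snd Q \<ge> 0"
  shows "emeasure lebesgue (cube_set Q) = ennreal (snd Q ^ CARD('n))"
proof (rule antisym)
  let ?u = "fst Q + (\<chi> i. snd Q)"
  have c: "emeasure lebesgue (cbox (fst Q) ?u) = ennreal (snd Q ^ CARD('n))"
  proof -
    have ne: "cbox (fst Q) ?u \<noteq> {}"
      using assms by (auto simp: interval_ne_empty_cart)
    have "emeasure lebesgue (cbox (fst Q) ?u) = ennreal (measure lborel (cbox (fst Q) ?u))"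
    proof -
      have "emeasure lborel (cbox (fst Q) ?u) \<noteq> \<infinity>"
        using emeasure_lborel_cbox_finite[of "fst Q" ?u] by (rule less_imp_neq)
      then have "emeasure lborel (cbox (fst Q) ?u) = ennreal (measure lborel (cbox (fst Q) ?u))"
        by (intro emeasure_eq_ennreal_measure) (simp only: infinity_ennreal_def not_False_eq_True)
      moreover have "emeasure lebesgue (cbox (fst Q) ?u) = emeasure lborel (cbox (fst Q) ?u)"
        by simp
      ultimately show ?thesis by (rule trans[rotated])
    qed
    then show ?thesis
      by (simp add: content_cbox_cart[OF ne])
  qed
  show "emeasure lebesgue (cube_set Q) \<le> ennreal (snd Q ^ CARD('n))"
    unfolding c[symmetric]
    by (rule emeasure_mono) (auto simp: cube_set_def mem_box_cart less_imp_le)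
  show "ennreal (snd Q ^ CARD('n)) \<le> emeasure lebesgue (cube_set Q)"
  proof -
    have "emeasure lebesgue (box (fst Q) ?u) = emeasure lebesgue (cbox (fst Q) ?u)"
      by (simp add: emeasure_lborel_cbox_eq emeasure_lborel_box_eq)
    also have "\<dots> = ennreal (snd Q ^ CARD('n))"
      by (rule c)
    finally have "ennreal (snd Q ^ CARD('n)) = emeasure lebesgue (box (fst Q) ?u)" ..
    also have "\<dots> \<le> emeasure lebesgue (cube_set Q)"
      by (rule emeasure_mono) (auto simp: cube_set_def mem_box_cart less_imp_le)
    finally show ?thesis .
  qed
qed

lemma corner_in_cube: "is_cube Q \<Longrightarrow> fst Q \<in> cube_set Q"
  by (auto simp: is_cube_def cube_set_def)

lemma cube_set_subset_iff:
  assumes R: "is_cube R"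
  shows "cube_set R \<subseteq> cube_set S \<longleftrightarrow>
    (\<forall>i. fst S $ i \<le> fst R $ i \<and> fst R $ i + snd R \<le> fst S $ i + snd S)"
proof
  assume sub: "cube_set R \<subseteq> cube_set S"
  show "\<forall>i. fst S $ i \<le> fst R $ i \<and> fst R $ i + snd R \<le> fst S $ i + snd S"
  proof
    fix i
    have 1: "fst S $ i \<le> fst R $ i"
      using corner_in_cube[OF R] sub by (auto simp: cube_set_def)
    have "fst R $ i + snd R \<le> fst S $ i + snd S"
    proof (rule ccontr)
      assume *: "\<not> ?thesis"
      \<comment> \<open>The corner of \<open>R\<close> with coordinate \<open>i\<close> pushed up to
        the upper face of \<open>S\<close>; the maximum keeps the point in \<open>R\<close>.\<close>
      define y where "y = (\<chi> j. if j = i then max (fst R $ i) (fst S $ i + snd S) else fst R $ j)"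
      have "y \<in> cube_set R"
        using * R by (auto simp: y_def cube_set_def is_cube_def)
      then have "y \<in> cube_set S"
        using sub by blast
      then have "y $ i < fst S $ i + snd S"
        by (auto simp: cube_set_def)
      then show False
        by (simp add: y_def)
    qed
    with 1 show "fst S $ i \<le> fst R $ i \<and> fst R $ i + snd R \<le> fst S $ i + snd S" by simp
  qed
next
  assume *: "\<forall>i. fst S $ i \<le> fst R $ i \<and> fst R $ i + snd R \<le> fst S $ i + snd S"
  have "fst S $ i \<le> x $ i \<and> x $ i < fst S $ i + snd S" if "x \<in> cube_set R" for x i
  proof -
    have "fst R $ i \<le> x $ i \<and> x $ i < fst R $ i + snd R"
      using that by (simp add: cube_set_def)
    moreover have "fst S $ i \<le> fst R $ i \<and> fst R $ i + snd R \<le> fst S $ i + snd S"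
      using * by blast
    ultimately show ?thesis by linarith
  qed
  then show "cube_set R \<subseteq> cube_set S"
    unfolding cube_set_def by blast
qed

lemma snd_mono_cube:
  assumes "is_cube R" "cube_set R \<subseteq> cube_set S"
  shows "snd R \<le> snd S"
proof -
  have "fst S $ i \<le> fst R $ i \<and> fst R $ i + snd R \<le> fst S $ i + snd S" for i
    using assms by (simp add: cube_set_subset_iff)
  from this[of undefined] show ?thesis
    by linarith
qed

section \<open>Concentric dilates\<close>

lemma snd_scale_cube [simp]: "snd (scale_cube lam Q) = lam * snd Q"
  by (simp add: scale_cube_def)

lemma is_cube_scale_cube [simp]: "lam > 0 \<Longrightarrow> is_cube (scale_cube lam Q) \<longleftrightarrow> is_cube Q"
  by (simp add: is_cube_def zero_less_mult_iff)

text \<open>Dilation adds a margin of \<open>(lam - 1) / 2\<close> sidelengths on every side, and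
  the smaller cube receives the smaller margin.\<close>

lemma scale_cube_mono:
  assumes "is_cube R" "cube_set R \<subseteq> cube_set S" "1 \<le> lam"
  shows "cube_set (scale_cube lam R) \<subseteq> cube_set (scale_cube lam S)"
proof -
  have rs: "snd R \<le> snd S"
    using assms snd_mono_cube by blast
  have le: "(lam - 1) * snd R \<le> (lam - 1) * snd S"
    using rs assms by (intro mult_left_mono) auto
  have R: "is_cube (scale_cube lam R)"
    using assms by simp
  show ?thesis
    unfolding cube_set_subset_iff[OF R]
  proof
    fix i
    have "fst S $ i \<le> fst R $ i" "fst R $ i + snd R \<le> fst S $ i + snd S"
      using assms(1,2) by (auto simp: cube_set_subset_iff)
    with le show "fst (scale_cube lam S) $ i \<le> fst (scale_cube lam R) $ i \<and>
      fst (scale_cube lam R) $ i + snd (scale_cube lam R) \<le> fst (scale_cube lam S) $ i + snd (scale_cube lam S)"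
      by (simp add: scale_cube_def field_simps)
  qed
qed

lemma scale_cube_incr:
  assumes "is_cube Q" "lam \<le> mu" "lam > 0"
  shows "cube_set (scale_cube lam Q) \<subseteq> cube_set (scale_cube mu Q)"
proof -
  have "lam * snd Q \<le> mu * snd Q"
    using assms by (auto simp: is_cube_def intro: mult_right_mono)
  moreover have "is_cube (scale_cube lam Q)"
    using assms by simp
  ultimately show ?thesis
    by (simp add: cube_set_subset_iff) (simp add: scale_cube_def field_simps)
qed

lemma scale_cube_1 [simp]: "scale_cube 1 Q = Q"
  by (auto simp: scale_cube_def prod_eq_iff vec_eq_iff)

lemma cube_subset_double: "is_cube Q \<Longrightarrow> cube_set Q \<subseteq> cube_set (scale_cube 2 Q)"
  using scale_cube_incr[of Q 1 2] by simp

lemma cube_subset_cball: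
  fixes S :: "'n::finite cube"
  shows "cube_set S \<subseteq> cball (fst S) (real CARD('n) * snd S)"
proof
  fix x assume x: "x \<in> cube_set S"
  have "norm (x - fst S) \<le> (\<Sum>i\<in>UNIV. \<bar>(x - fst S) $ i\<bar>)"
    by (rule norm_le_l1_cart)
  also have "\<dots> \<le> (\<Sum>i\<in>(UNIV::'n set). snd S)"
  proof (rule sum_mono)
    fix i :: 'n
    have "fst S $ i \<le> x $ i \<and> x $ i < fst S $ i + snd S"
      using x by (simp add: cube_set_def)
    then show "\<bar>(x - fst S) $ i\<bar> \<le> snd S"
      by (simp add: abs_le_iff)
  qed
  finally show "x \<in> cball (fst S) (real CARD('n) * snd S)"
    by (simp add: dist_norm norm_minus_commute)
qed

section \<open>Countable families, counting measure and Vitali selection\<close>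

lemma nn_integral_count_space_le:
  fixes f :: "'a \<Rightarrow> ennreal"
  assumes "countable G" and le: "\<And>F. finite F \<Longrightarrow> F \<subseteq> G \<Longrightarrow> sum f F \<le> A"
  shows "(\<integral>\<^sup>+x. f x \<partial>count_space G) \<le> A"
proof (cases "finite G")
  case True
  then show ?thesis
    using le by (simp add: nn_integral_count_space_finite)
next
  case False
  then have b: "bij_betw (from_nat_into G) UNIV G"
    using assms(1) by (simp add: bij_betw_from_nat_into)
  have "(\<integral>\<^sup>+x. f x \<partial>count_space G) = (\<integral>\<^sup>+i. f (from_nat_into G i) \<partial>count_space UNIV)"
    using nn_integral_bij_count_space[OF b, of f] by simp
  also have "\<dots> = (\<Sum>i. f (from_nat_into G i))"
    by (rule nn_integral_count_space_nat)
  also have "\<dots> \<le> A"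
  proof (rule suminf_le_const)
    fix n
    have "(\<Sum>i<n. f (from_nat_into G i)) = sum f (from_nat_into G ` {..<n})"
      using b by (subst sum.reindex) (auto simp: bij_betw_def intro: inj_on_subset)
    also have "\<dots> \<le> A"
      using b by (intro le) (auto simp: bij_betw_def)
    finally show "(\<Sum>i<n. f (from_nat_into G i)) \<le> A" .
  qed auto
  finally show ?thesis .
qed

text \<open>The indicator of a union is at most the sum of the indicators. Integrating against
  \<open>count_space\<close> lets a family of cubes index itself, without an enumeration.\<close>

lemma emeasure_UN_le_nn_integral:
  assumes "countable I" and [measurable]: "\<And>i. i \<in> I \<Longrightarrow> X i \<in> sets M"
  shows "emeasure M (\<Union>i\<in>I. X i) \<le> (\<integral>\<^sup>+i. emeasure M (X i) \<partial>count_space I)"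
proof -
  have m: "(\<Union>i\<in>I. X i) \<in> sets M"
    using assms by (intro sets.countable_UN'') auto
  have "emeasure M (\<Union>i\<in>I. X i) = (\<integral>\<^sup>+x. indicator (\<Union>i\<in>I. X i) x \<partial>M)"
    using m by simp
  also have "\<dots> \<le> (\<integral>\<^sup>+x. \<integral>\<^sup>+i. indicator (X i) x \<partial>count_space I \<partial>M)"
  proof (rule nn_integral_mono)
    fix x
    show "indicator (\<Union>i\<in>I. X i) x \<le> (\<integral>\<^sup>+i. (indicator (X i) x :: ennreal) \<partial>count_space I)"
    proof (cases "x \<in> (\<Union>i\<in>I. X i)")
      case True
      then obtain i where i: "i \<in> I" "x \<in> X i" by blast
      have "(indicator (X i) x :: ennreal) \<le> (\<integral>\<^sup>+i. indicator (X i) x \<partial>count_space I)"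
        using i(1) by (rule nn_integral_ge_point)
      with i show ?thesis by (auto simp: indicator_def)
    qed simp
  qed
  also have "\<dots> = (\<integral>\<^sup>+i. emeasure M (X i) \<partial>count_space I)"
    using assms by (subst nn_integral_count_space_nn_integral) (auto intro!: nn_integral_cong)
  finally show ?thesis .
qed

text \<open>With n the dimension, this is the volume of a ball of radius 5 n l divided by that of a
  cube of side l: the ball of radius n l around the corner contains the cube, and 5 is Vitali's
  enlargement.\<close>

definition vitali_const :: "'n::finite itself \<Rightarrow> real" where
  "vitali_const _ = unit_ball_vol (real CARD('n)) * (5 * real CARD('n)) ^ CARD('n)"

lemma vitali_const_pos: "vitali_const TYPE('n::finite) > 0"
  by (simp add: vitali_const_def)

text \<open>Vitali's lemma is applied to balls containing the cubes: disjoint balls contain disjoint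
  cubes, and each enlarged ball has volume proportional to that of its cube.\<close>

lemma Vitali_cubes:
  fixes F :: "'n::finite cube set"
  assumes F: "\<And>S. S \<in> F \<Longrightarrow> 0 < snd S \<and> snd S \<le> b" and X: "X \<subseteq> (\<Union>S\<in>F. cube_set S)"
  obtains G where "countable G" "G \<subseteq> F" "disjoint_family_on cube_set G"
    "emeasure lebesgue X \<le> ennreal (vitali_const TYPE('n)) * (\<integral>\<^sup>+S. emeasure lebesgue (cube_set S) \<partial>count_space G)"
proof -
  let ?N = "real CARD('n)"
  have X': "X \<subseteq> (\<Union>S\<in>F. cball (fst S) (?N * snd S))"
    using X cube_subset_cball by blast
  have r: "0 < ?N * snd S \<and> ?N * snd S \<le> ?N * b" if "S \<in> F" for S
    using F[OF that] by auto
  obtain G where G: "countable G" "G \<subseteq> F"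
     "pairwise (\<lambda>i j. disjnt (cball (fst i) (?N * snd i)) (cball (fst j) (?N * snd j))) G"
     "X \<subseteq> (\<Union>S\<in>G. cball (fst S) (5 * (?N * snd S)))"
    using Vitali_covering_lemma_cballs[OF X' r] by blast
  have disj: "disjoint_family_on cube_set G"
    unfolding disjoint_family_on_def
  proof (intro ballI impI)
    fix R S assume "R \<in> G" "S \<in> G" "R \<noteq> S"
    then have "cball (fst R) (?N * snd R) \<inter> cball (fst S) (?N * snd S) = {}"
      using G(3) by (auto simp: pairwise_def disjnt_def)
    then show "cube_set R \<inter> cube_set S = {}"
      using cube_subset_cball[of R] cube_subset_cball[of S] by blast
  qed
  have ball: "emeasure lebesgue (cball (fst S) (5 * (?N * snd S)))
      = ennreal (vitali_const TYPE('n)) * emeasure lebesgue (cube_set S)" if "S \<in> G" for S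
  proof -
    have s: "snd S > 0" using F G that by blast
    have "emeasure lebesgue (cball (fst S) (5 * (?N * snd S)))
      = ennreal (unit_ball_vol (real DIM(real^'n)) * (5 * (?N * snd S)) ^ DIM(real^'n))"
      using s by (simp add: emeasure_cball)
    also have "unit_ball_vol (real DIM(real^'n)) * (5 * (?N * snd S)) ^ DIM(real^'n)
       = vitali_const TYPE('n) * snd S ^ CARD('n)"
      by (simp add: vitali_const_def power_mult_distrib)
    finally show ?thesis
      using s vitali_const_pos[where 'n='n] by (subst emeasure_cube_set) (auto simp: ennreal_mult)
  qed
  have "emeasure lebesgue X \<le> emeasure lebesgue (\<Union>S\<in>G. cball (fst S) (5 * (?N * snd S)))"
    using G(1,4) by (intro emeasure_mono sets.countable_UN'') auto
  also have "\<dots> \<le> (\<integral>\<^sup>+S. emeasure lebesgue (cball (fst S) (5 * (?N * snd S))) \<partial>count_space G)"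
    using G(1) by (intro emeasure_UN_le_nn_integral) auto
  also have "\<dots> = (\<integral>\<^sup>+S. ennreal (vitali_const TYPE('n)) * emeasure lebesgue (cube_set S) \<partial>count_space G)"
    using ball by (intro nn_integral_cong) auto
  also have "\<dots> = ennreal (vitali_const TYPE('n)) * (\<integral>\<^sup>+S. emeasure lebesgue (cube_set S) \<partial>count_space G)"
    by (simp add: nn_integral_cmult)
  finally show thesis
    using that G(1,2) disj by blast
qed

section \<open>Dyadic subcubes and stopping families\<close>

text \<open>The cell of generation \<open>k\<close> around \<open>x\<close> in the dyadic grid
  generated by \<open>Q\<close>. Naming cells by a point makes the ancestors of a cell the cells of
  the same point with smaller \<open>k\<close>.\<close>

definition dyadic_cube :: "'n::finite cube \<Rightarrow> nat \<Rightarrow> real^'n \<Rightarrow> 'n cube" where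
  "dyadic_cube Q k x = ((\<chi> i. fst Q $ i + real_of_int \<lfloor>(x $ i - fst Q $ i) * 2 ^ k / snd Q\<rfloor> * (snd Q / 2 ^ k)),
     snd Q / 2 ^ k)"

lemma snd_dyadic_cube [simp]: "snd (dyadic_cube Q k x) = snd Q / 2 ^ k"
  by (simp add: dyadic_cube_def)

lemma is_cube_dyadic_cube [simp]: "is_cube (dyadic_cube Q k x) \<longleftrightarrow> is_cube Q"
  by (simp add: is_cube_def zero_less_divide_iff)

lemma mem_dyadic_cube_iff:
  assumes "is_cube Q"
  shows "y \<in> cube_set (dyadic_cube Q k x) \<longleftrightarrow>
    (\<forall>i. \<lfloor>(y $ i - fst Q $ i) * 2 ^ k / snd Q\<rfloor> = \<lfloor>(x $ i - fst Q $ i) * 2 ^ k / snd Q\<rfloor>)"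
proof -
  have "(fst (dyadic_cube Q k x) $ i \<le> y $ i \<and> y $ i < fst (dyadic_cube Q k x) $ i + snd (dyadic_cube Q k x)) \<longleftrightarrow>
    \<lfloor>(y $ i - fst Q $ i) * 2 ^ k / snd Q\<rfloor> = \<lfloor>(x $ i - fst Q $ i) * 2 ^ k / snd Q\<rfloor>" for i
    using assms unfolding floor_eq_iff by (simp add: dyadic_cube_def is_cube_def field_simps)
  then show ?thesis
    by (simp add: cube_set_def)
qed

lemma self_mem_dyadic_cube: "is_cube Q \<Longrightarrow> x \<in> cube_set (dyadic_cube Q k x)"
  by (simp add: mem_dyadic_cube_iff)

lemma dyadic_cube_eq: "is_cube Q \<Longrightarrow> y \<in> cube_set (dyadic_cube Q k x) \<Longrightarrow> dyadic_cube Q k y = dyadic_cube Q k x"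
  by (simp add: mem_dyadic_cube_iff) (simp add: dyadic_cube_def)

text \<open>The floor of w is the floor of 2 w halved and rounded down, so the index of a cell
  determines the index of its parent.\<close>

lemma dyadic_cube_Suc_subset:
  assumes "is_cube Q"
  shows "cube_set (dyadic_cube Q (Suc k) x) \<subseteq> cube_set (dyadic_cube Q k x)"
proof
  fix y assume y: "y \<in> cube_set (dyadic_cube Q (Suc k) x)"
  have half: "\<lfloor>w\<rfloor> = \<lfloor>2 * w\<rfloor> div 2" for w :: real
    using floor_divide_real_eq_div[of 2 "2 * w"] by simp
  have e: "2 * ((z $ i - fst Q $ i) * 2 ^ k / snd Q) = (z $ i - fst Q $ i) * 2 ^ Suc k / snd Q" for z i
    by simp
  have y': "\<lfloor>(y $ i - fst Q $ i) * 2 ^ Suc k / snd Q\<rfloor> = \<lfloor>(x $ i - fst Q $ i) * 2 ^ Suc k / snd Q\<rfloor>" for i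
    using y unfolding mem_dyadic_cube_iff[OF assms] by blast
  have "\<lfloor>(y $ i - fst Q $ i) * 2 ^ k / snd Q\<rfloor> = \<lfloor>(x $ i - fst Q $ i) * 2 ^ k / snd Q\<rfloor>" for i
    by (subst half, subst (2) half) (simp only: e y')
  then show "y \<in> cube_set (dyadic_cube Q k x)"
    unfolding mem_dyadic_cube_iff[OF assms] by blast
qed

lemma dyadic_cube_antimono:
  assumes "is_cube Q" "j \<le> k"
  shows "cube_set (dyadic_cube Q k x) \<subseteq> cube_set (dyadic_cube Q j x)"
  using lift_Suc_antimono_le[of "\<lambda>k. cube_set (dyadic_cube Q k x)"] dyadic_cube_Suc_subset assms by blast

text \<open>Points of one cell have the same ancestors; this takes the place of the dichotomy that
  dyadic cubes are nested or disjoint.\<close>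

lemma dyadic_cube_eq_le:
  assumes "is_cube Q" "j \<le> k" "y \<in> cube_set (dyadic_cube Q k x)"
  shows "dyadic_cube Q j y = dyadic_cube Q j x"
  using assms dyadic_cube_antimono dyadic_cube_eq by blast

lemma dyadic_cube_0:
  assumes "is_cube Q" "x \<in> cube_set Q"
  shows "dyadic_cube Q 0 x = Q"
proof -
  have "\<lfloor>(x $ i - fst Q $ i) / snd Q\<rfloor> = 0" for i
    using assms unfolding floor_eq_iff by (auto simp: cube_set_def is_cube_def field_simps)
  then show ?thesis
    by (simp add: dyadic_cube_def prod_eq_iff vec_eq_iff)
qed

lemma dyadic_cube_subset:
  "is_cube Q \<Longrightarrow> x \<in> cube_set Q \<Longrightarrow> cube_set (dyadic_cube Q k x) \<subseteq> cube_set Q"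
  using dyadic_cube_antimono[of Q 0 k x] dyadic_cube_0[of Q x] by simp

text \<open>Each cell has nonempty interior, hence contains a point of a countable dense set, and
  that point together with the generation names the cell.\<close>

lemma countable_dyadic_cube:
  fixes Q :: "'n::finite cube"
  assumes "is_cube Q"
  shows "countable {dyadic_cube Q k x | k x. True}"
proof -
  obtain D :: "(real^'n) set" where D: "countable D" "\<And>X. open X \<Longrightarrow> X \<noteq> {} \<Longrightarrow> \<exists>d\<in>D. d \<in> X"
    using countable_dense_exists by blast
  have "{dyadic_cube Q k x | k x. True} \<subseteq> (\<lambda>(k, x). dyadic_cube Q k x) ` (UNIV \<times> D)"
  proof
    fix R assume "R \<in> {dyadic_cube Q k x | k x. True}"
    then obtain k x where R: "R = dyadic_cube Q k x" by blast
    let ?R = "dyadic_cube Q k x"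
    have s: "snd ?R > 0"
      using assms by (simp add: is_cube_def)
    have "box (fst ?R) (fst ?R + (\<chi> i. snd ?R)) \<noteq> {}"
      using s by (simp add: interval_ne_empty_cart)
    then obtain d where d: "d \<in> D" "d \<in> box (fst ?R) (fst ?R + (\<chi> i. snd ?R))"
      using D(2)[OF open_box] by blast
    then have "d \<in> cube_set ?R"
      by (auto simp: cube_set_def mem_box_cart less_imp_le)
    then have "dyadic_cube Q k x = dyadic_cube Q k d"
      using dyadic_cube_eq assms by metis
    then show "R \<in> (\<lambda>(k, x). dyadic_cube Q k x) ` (UNIV \<times> D)"
      using d(1) R by auto
  qed
  then show ?thesis
    by (rule countable_subset) (intro countable_image countable_SIGMA D(1) countableI_type)
qed

lemma dyadic_cube_shrinks:
  fixes Q :: "'n::finite cube"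
  assumes "is_cube Q" "open U" "x \<in> U"
  obtains k where "cube_set (dyadic_cube Q k x) \<subseteq> U"
proof -
  obtain e where e: "e > 0" "ball x e \<subseteq> U"
    using assms openE by blast
  let ?N = "real CARD('n)"
  \<comment> \<open>The factor 2 arises because both points of the cell are compared with its
    corner.\<close>
  have "(\<lambda>k. 2 * ?N * snd Q * (1/2) ^ k) \<longlonglongrightarrow> 2 * ?N * snd Q * 0"
    by (intro tendsto_mult_left LIMSEQ_realpow_zero) auto
  then have "eventually (\<lambda>k. 2 * ?N * snd Q * (1/2) ^ k < e) sequentially"
    using e(1) by (intro order_tendstoD(2)) auto
  then obtain k where k: "2 * ?N * snd Q * (1/2) ^ k < e"
    using eventually_happens by fastforce
  have "cube_set (dyadic_cube Q k x) \<subseteq> ball x e"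
  proof
    fix y assume y: "y \<in> cube_set (dyadic_cube Q k x)"
    let ?c = "fst (dyadic_cube Q k x)"
    define \<rho> where "\<rho> = ?N * (snd Q / 2 ^ k)"
    have "dist ?c y \<le> \<rho>" "dist ?c x \<le> \<rho>"
      using y self_mem_dyadic_cube[OF assms(1), of x k] cube_subset_cball[of "dyadic_cube Q k x"]
      unfolding \<rho>_def by auto
    then have "dist x y \<le> 2 * \<rho>"
      using dist_triangle3[of x y ?c] by linarith
    also have "\<dots> < e"
      using k by (simp add: power_divide \<rho>_def)
    finally show "y \<in> ball x e" by simp
  qed
  with e that show thesis by blast
qed

text \<open>The Calderon-Zygmund selection: the maximal dyadic subcubes of \<open>Q\<close> with
  property \<open>P\<close>, found as the first success when descending from \<open>Q\<close>
  towards a point.\<close>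

definition stopping :: "'n::finite cube \<Rightarrow> ('n cube \<Rightarrow> bool) \<Rightarrow> 'n cube set" where
  "stopping Q P = {dyadic_cube Q k x | k x. x \<in> cube_set Q \<and> P (dyadic_cube Q k x) \<and> (\<forall>j<k. \<not> P (dyadic_cube Q j x))}"

lemma countable_stopping:
  assumes "is_cube Q" shows "countable (stopping Q P)"
  by (rule countable_subset[OF _ countable_dyadic_cube[OF assms]]) (auto simp: stopping_def)

text \<open>If two selected cubes share a point, both are the first success on the chain of that
  point, so their generations and hence the cubes agree.\<close>

lemma stopping_disjoint:
  assumes Q: "is_cube Q" shows "disjoint_family_on cube_set (stopping Q P)"
  unfolding disjoint_family_on_def
proof (intro ballI impI, rule ccontr)
  fix R S assume RS: "R \<in> stopping Q P" "S \<in> stopping Q P" "R \<noteq> S" "cube_set R \<inter> cube_set S \<noteq> {}"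
  then obtain z where z: "z \<in> cube_set R" "z \<in> cube_set S" by blast
  obtain k x where x: "R = dyadic_cube Q k x" "P (dyadic_cube Q k x)" "\<And>j. j < k \<Longrightarrow> \<not> P (dyadic_cube Q j x)"
    using RS(1) by (auto simp: stopping_def)
  obtain l y where y: "S = dyadic_cube Q l y" "P (dyadic_cube Q l y)" "\<And>j. j < l \<Longrightarrow> \<not> P (dyadic_cube Q j y)"
    using RS(2) by (auto simp: stopping_def)
  have zx: "dyadic_cube Q j z = dyadic_cube Q j x" if "j \<le> k" for j
    using dyadic_cube_eq_le[OF Q that] z(1) x(1) by simp
  have zy: "dyadic_cube Q j z = dyadic_cube Q j y" if "j \<le> l" for j
    using dyadic_cube_eq_le[OF Q that] z(2) y(1) by simp
  have "k = l"
    using x y zx zy by (metis le_refl less_imp_le linorder_neqE_nat)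
  then show False
    using RS(3) x(1) y(1) zx[of k] zy[of l] by simp
qed

lemma Union_stopping:
  assumes Q: "is_cube Q"
  shows "(\<Union>R\<in>stopping Q P. cube_set R) = {x \<in> cube_set Q. \<exists>k. P (dyadic_cube Q k x)}"
proof (intro equalityI subsetI)
  fix z assume "z \<in> (\<Union>R\<in>stopping Q P. cube_set R)"
  then obtain k x where x: "z \<in> cube_set (dyadic_cube Q k x)" "x \<in> cube_set Q" "P (dyadic_cube Q k x)"
    by (auto simp: stopping_def)
  then have "dyadic_cube Q k z = dyadic_cube Q k x"
    using dyadic_cube_eq Q by blast
  with x show "z \<in> {x \<in> cube_set Q. \<exists>k. P (dyadic_cube Q k x)}"
    using dyadic_cube_subset[OF Q x(2)] by (auto intro!: exI[of _ k])
next
  fix z assume "z \<in> {x \<in> cube_set Q. \<exists>k. P (dyadic_cube Q k x)}"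
  then have z: "z \<in> cube_set Q" "\<exists>k. P (dyadic_cube Q k z)" by auto
  then have "dyadic_cube Q (LEAST k. P (dyadic_cube Q k z)) z \<in> stopping Q P"
    unfolding stopping_def using LeastI_ex[OF z(2)] not_less_Least by blast
  then show "z \<in> (\<Union>R\<in>stopping Q P. cube_set R)"
    using self_mem_dyadic_cube[OF Q] by blast
qed

lemma stopping_subset:
  assumes "is_cube Q" "R \<in> stopping Q P" shows "cube_set R \<subseteq> cube_set Q" "is_cube R" "P R"
  using assms dyadic_cube_subset by (fastforce simp: stopping_def)+

lemma stopping_sets [measurable, simp]:
  assumes "is_cube Q" shows "(\<Union>R\<in>stopping Q P. cube_set R) \<in> sets lebesgue"
  using countable_stopping[OF assms] by (intro sets.countable_UN'') auto

text \<open>One half of Lebesgue differentiation, for arbitrary nonnegative densities. If the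
  exceptional set had positive measure, a dyadic cover inside a slightly larger open set would have
  averages at most \<open>S\<close>, although \<open>H\<close> exceeds \<open>S\<close> by a fixed
  margin on the set itself.\<close>

lemma dyadic_differentiation:
  fixes H :: "real^'n::finite \<Rightarrow> ennreal" and S :: real
  assumes Q: "is_cube Q" and H [measurable]: "H \<in> borel_measurable lebesgue" and S: "S \<ge> 0"
  shows "{x \<in> cube_set Q. ennreal S < H x \<and>
     (\<forall>k. emeasure (density lebesgue H) (cube_set (dyadic_cube Q k x)) \<le> ennreal S * emeasure lebesgue (cube_set (dyadic_cube Q k x)))} \<in> null_sets lebesgue"
proof -
  let ?\<nu> = "density lebesgue H"
  define P where "P R \<longleftrightarrow> \<not> ?\<nu> (cube_set R) \<le> ennreal S * emeasure lebesgue (cube_set R)" for R :: "'n cube"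
  let ?Om = "\<Union>R\<in>stopping Q P. cube_set R"
  \<comment> \<open>Off \<open>?Om\<close> every dyadic average is at most \<open>S\<close>. The
    margin \<open>1 / real (Suc m)\<close> makes the strict inequality quantitative, at the price of
    a countable union.\<close>
  define E where "E m = {x \<in> cube_set Q. ennreal (S + 1 / real (Suc m)) \<le> H x} - ?Om" for m
  have Em: "E m \<in> sets lebesgue" for m
  proof -
    have "{x \<in> cube_set Q. ennreal (S + 1 / real (Suc m)) \<le> H x}
      = cube_set Q \<inter> {x \<in> space lebesgue. ennreal (S + 1 / real (Suc m)) \<le> H x}" by auto
    also have "\<dots> \<in> sets lebesgue"
    proof (intro sets.Int)
      show "{x \<in> space lebesgue. ennreal (S + 1 / real (Suc m)) \<le> H x} \<in> sets lebesgue"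
        by measurable
    qed simp
    finally show ?thesis
      using Q by (auto simp: E_def)
  qed
  have null: "emeasure lebesgue (E m) = 0" for m
  proof -
    have "emeasure lebesgue (E m) \<le> emeasure lebesgue (cube_set Q)"
      by (intro emeasure_mono) (auto simp: E_def)
    also have "\<dots> < top"
      using Q by (subst emeasure_cube_set) (auto simp: is_cube_def)
    finally obtain y where y: "y \<ge> 0" "emeasure lebesgue (E m) = ennreal y"
      by (cases "emeasure lebesgue (E m)") auto
    \<comment> \<open>The integral of \<open>H\<close> over \<open>E m\<close> is bounded below by
      the height and above by the averages on a dyadic cover of measure at most
      \<open>y + \<delta>\<close>.\<close>
    have "(S + 1 / real (Suc m)) * y \<le> S * (y + \<delta>)" if "\<delta> > 0" for \<delta>
    proof -
      obtain U where U: "open U" "E m \<subseteq> U" "U - E m \<in> lmeasurable" "emeasure lebesgue (U - E m) < ennreal \<delta>"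
        using sets_lebesgue_outer_open[OF Em \<open>\<delta> > 0\<close>] by blast
      have Us: "U \<in> sets lebesgue"
        using U(1) by (simp add: sets_completionI_sets)
      \<comment> \<open>Cubes inside \<open>U\<close> keep the total measure small; meeting
        \<open>E m\<close> forces their averages to be at most \<open>S\<close>.\<close>
      define P' where "P' R \<longleftrightarrow> cube_set R \<subseteq> U \<and> cube_set R \<inter> E m \<noteq> {}" for R :: "'n cube"
      let ?F = "stopping Q P'"
      have cov: "E m \<subseteq> (\<Union>R\<in>?F. cube_set R)"
        unfolding Union_stopping[OF Q]
      proof
        fix x assume x: "x \<in> E m"
        then obtain k where "cube_set (dyadic_cube Q k x) \<subseteq> U"
          using dyadic_cube_shrinks[OF Q U(1)] U(2) by blast
        then have "P' (dyadic_cube Q k x)"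
          using x self_mem_dyadic_cube[OF Q] by (auto simp: P'_def)
        then show "x \<in> {x \<in> cube_set Q. \<exists>k. P' (dyadic_cube Q k x)}"
          using x by (auto simp: E_def)
      qed
      have avg: "emeasure ?\<nu> (cube_set R) \<le> ennreal S * emeasure lebesgue (cube_set R)" if "R \<in> ?F" for R
      proof -
        obtain k x where R: "R = dyadic_cube Q k x" using \<open>R \<in> ?F\<close> by (auto simp: stopping_def)
        obtain z where z: "z \<in> cube_set R" "z \<in> E m"
          using stopping_subset(3)[OF Q \<open>R \<in> ?F\<close>] by (auto simp: P'_def)
        have "dyadic_cube Q k z = R"
          using z(1) R dyadic_cube_eq[OF Q] by blast
        moreover have "z \<notin> ?Om" "z \<in> cube_set Q"
          using z(2) by (auto simp: E_def)
        ultimately have "\<not> P R"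
          using Union_stopping[OF Q, of P] by auto
        then show ?thesis by (simp add: P_def)
      qed
      have "ennreal ((S + 1 / real (Suc m)) * y) = ennreal (S + 1 / real (Suc m)) * emeasure lebesgue (E m)"
        using S y by (simp add: ennreal_mult del: ennreal_plus)
      also have "\<dots> = (\<integral>\<^sup>+x. ennreal (S + 1 / real (Suc m)) * indicator (E m) x \<partial>lebesgue)"
        using Em by (simp add: nn_integral_cmult del: ennreal_plus)
      also have "\<dots> \<le> (\<integral>\<^sup>+x. H x * indicator (E m) x \<partial>lebesgue)"
        by (intro nn_integral_mono) (auto simp: E_def indicator_def)
      also have "\<dots> = emeasure ?\<nu> (E m)"
        using Em by (simp add: emeasure_density)
      also have "\<dots> \<le> emeasure ?\<nu> (\<Union>R\<in>?F. cube_set R)"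
        using Q by (intro emeasure_mono cov) auto
      also have "\<dots> = (\<integral>\<^sup>+R. emeasure ?\<nu> (cube_set R) \<partial>count_space ?F)"
        using Q by (intro emeasure_UN_countable countable_stopping stopping_disjoint) auto
      also have "\<dots> \<le> (\<integral>\<^sup>+R. ennreal S * emeasure lebesgue (cube_set R) \<partial>count_space ?F)"
        using avg by (intro nn_integral_mono) auto
      also have "\<dots> = ennreal S * (\<integral>\<^sup>+R. emeasure lebesgue (cube_set R) \<partial>count_space ?F)"
        by (simp add: nn_integral_cmult)
      also have "(\<integral>\<^sup>+R. emeasure lebesgue (cube_set R) \<partial>count_space ?F) = emeasure lebesgue (\<Union>R\<in>?F. cube_set R)"
        using Q by (intro emeasure_UN_countable[symmetric] countable_stopping stopping_disjoint) auto
      also have "\<dots> \<le> emeasure lebesgue U"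
        using Us stopping_subset(3)[OF Q, of _ P'] by (intro emeasure_mono) (auto simp: P'_def)
      also have "\<dots> = emeasure lebesgue (E m \<union> (U - E m))"
        using U(2) by (intro arg_cong[where f="emeasure lebesgue"]) auto
      also have "\<dots> \<le> emeasure lebesgue (E m) + emeasure lebesgue (U - E m)"
        using Em Us by (intro emeasure_subadditive) auto
      also have "\<dots> \<le> ennreal y + ennreal \<delta>"
        using U(4) y(2) by (intro add_mono) auto
      also have "ennreal S * (ennreal y + ennreal \<delta>) = ennreal (S * (y + \<delta>))"
        using S y(1) that by (simp add: ennreal_mult)
      finally have "ennreal ((S + 1 / real (Suc m)) * y) \<le> ennreal (S * (y + \<delta>))"
        by (simp add: mult_left_mono)
      then show ?thesis
        using S y(1) that by (subst (asm) ennreal_le_iff) auto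
    qed
    then have *: "y / real (Suc m) \<le> S * \<delta>" if "\<delta> > 0" for \<delta>
      using that by (fastforce simp: algebra_simps)
    have "y / real (Suc m) \<le> 0"
    proof (rule field_le_epsilon)
      fix e :: real assume "e > 0"
      \<comment> \<open>Dividing by \<open>S + 1\<close> covers the case \<open>S = 0\<close> as
        well.\<close>
      have "y / real (Suc m) \<le> S * (e / (S + 1))"
        using \<open>e > 0\<close> S by (intro *) simp
      also have "\<dots> \<le> (S + 1) * (e / (S + 1))"
        using \<open>e > 0\<close> S by (intro mult_right_mono) auto
      finally show "y / real (Suc m) \<le> 0 + e"
        using S by simp
    qed
    then show ?thesis
      using y by (simp add: divide_le_0_iff)
  qed
  have "(\<Union>m. E m) \<in> null_sets lebesgue"
    using Em null by (intro null_sets_UN) auto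
  moreover have "{x \<in> cube_set Q. ennreal S < H x \<and>
     (\<forall>k. emeasure ?\<nu> (cube_set (dyadic_cube Q k x)) \<le> ennreal S * emeasure lebesgue (cube_set (dyadic_cube Q k x)))} \<subseteq> (\<Union>m. E m)"
  proof clarify
    fix x assume x: "x \<in> cube_set Q" "ennreal S < H x"
       "\<forall>k. emeasure ?\<nu> (cube_set (dyadic_cube Q k x)) \<le> ennreal S * emeasure lebesgue (cube_set (dyadic_cube Q k x))"
    then have om: "x \<notin> ?Om"
      unfolding Union_stopping[OF Q] by (auto simp: P_def)
    have "\<exists>m. ennreal (S + 1 / real (Suc m)) \<le> H x"
    proof (cases "H x")
      case (real r)
      then have "r - S > 0" using x(2) S by (auto simp: ennreal_less_iff)
      then obtain m where "inverse (real (Suc m)) < r - S"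
        using reals_Archimedean by blast
      then show ?thesis
        using real S by (intro exI[of _ m]) (auto simp: inverse_eq_divide intro!: ennreal_leI simp del: ennreal_plus)
    qed auto
    then show "x \<in> (\<Union>m. E m)"
      using om x(1) by (auto simp: E_def)
  qed
  ultimately show ?thesis
    by (metis (no_types, lifting) null_sets_completion_subset)
qed

section \<open>Weak-type and numerical estimates\<close>

text \<open>The weak-type estimate for a maximal operator: on a disjoint Vitali subfamily the masses
  of \<open>g\<close> add up to at most its mass on \<open>E\<close>.\<close>

lemma weak_type_cubes:
  fixes F :: "'n::finite cube set" and g :: "real^'n \<Rightarrow> ennreal" and \<sigma> :: ennreal
  assumes F: "\<And>S. S \<in> F \<Longrightarrow> 0 < snd S \<and> snd S \<le> b" and X: "X \<subseteq> (\<Union>S\<in>F. cube_set S)"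
    and g [measurable]: "g \<in> borel_measurable lebesgue" and E: "E \<in> sets lebesgue"
    and avg: "\<And>S. S \<in> F \<Longrightarrow> cube_set S \<subseteq> E \<and>
      \<sigma> * emeasure lebesgue (cube_set S) \<le> emeasure (density lebesgue g) (cube_set S)"
  shows "\<sigma> * emeasure lebesgue X \<le> ennreal (vitali_const TYPE('n)) * emeasure (density lebesgue g) E"
proof -
  let ?V = "ennreal (vitali_const TYPE('n))" and ?\<nu> = "density lebesgue g"
  obtain G where G: "countable G" "G \<subseteq> F" "disjoint_family_on cube_set G"
    "emeasure lebesgue X \<le> ?V * (\<integral>\<^sup>+S. emeasure lebesgue (cube_set S) \<partial>count_space G)"
    using Vitali_cubes[OF F X] by blast
  have "\<sigma> * emeasure lebesgue X \<le> \<sigma> * (?V * (\<integral>\<^sup>+S. emeasure lebesgue (cube_set S) \<partial>count_space G))"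
    using G(4) by (rule mult_left_mono) simp
  also have "\<dots> = ?V * (\<integral>\<^sup>+S. \<sigma> * emeasure lebesgue (cube_set S) \<partial>count_space G)"
    by (simp add: nn_integral_cmult mult_ac)
  also have "\<dots> \<le> ?V * (\<integral>\<^sup>+S. emeasure ?\<nu> (cube_set S) \<partial>count_space G)"
    using G(2) avg by (intro mult_left_mono nn_integral_mono) auto
  also have "(\<integral>\<^sup>+S. emeasure ?\<nu> (cube_set S) \<partial>count_space G) = emeasure ?\<nu> (\<Union>S\<in>G. cube_set S)"
    using G by (intro emeasure_UN_countable[symmetric]) auto
  also have "?V * \<dots> \<le> ?V * emeasure ?\<nu> E"
    using G(2) avg E by (intro mult_left_mono emeasure_mono) auto
  finally show ?thesis .
qed

text \<open>The bound of a \<open>p\<close>-average by \<open>T\<close>, raised to the power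
  \<open>p\<close> and cleared of the quotient, so that integrals can be added and compared without
  roots of extended reals.\<close>

definition avg_le :: "real \<Rightarrow> (real^'n::finite \<Rightarrow> real) \<Rightarrow> (real^'n) set \<Rightarrow> real \<Rightarrow> bool" where
  "avg_le p g E T \<longleftrightarrow>
    (\<integral>\<^sup>+x\<in>E. ennreal (\<bar>g x\<bar> powr p) \<partial>lebesgue) \<le> ennreal (T powr p) * emeasure lebesgue E"

lemma avg_le_mono:
  assumes "avg_le p g E s" "0 \<le> s" "s \<le> t" "0 \<le> p" shows "avg_le p g E t"
proof -
  have "ennreal (s powr p) * emeasure lebesgue E \<le> ennreal (t powr p) * emeasure lebesgue E"
    using assms by (intro mult_right_mono ennreal_leI powr_mono2) auto
  with assms(1) show ?thesis
    unfolding avg_le_def by (rule order_trans)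
qed

lemma emeasure_double_cube:
  fixes R :: "'n::finite cube"
  assumes "is_cube R"
  shows "emeasure lebesgue (cube_set (scale_cube 2 R)) = ennreal (2 ^ CARD('n)) * emeasure lebesgue (cube_set R)"
proof -
  have "emeasure lebesgue (cube_set (scale_cube 2 R)) = ennreal (2 ^ CARD('n) * snd R ^ CARD('n))"
    using assms by (subst emeasure_cube_set) (auto simp: is_cube_def power_mult_distrib)
  moreover have "emeasure lebesgue (cube_set R) = ennreal (snd R ^ CARD('n))"
    using assms by (intro emeasure_cube_set) (simp add: is_cube_def)
  ultimately show ?thesis
    using assms by (simp only:) (rule ennreal_mult, auto simp: is_cube_def)
qed

text \<open>The part of \<open>x\<close> below height \<open>s\<close> goes into the constant, the part above it is traded for an \<open>r\<close>-th
power; this replaces Jensen's inequality on the small cubes.\<close>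

lemma powr_add_le:
  fixes p r s x y :: real
  assumes "1 \<le> p" "p < r" "s > 0"
  shows "\<bar>x + y\<bar> powr p \<le> (2 * s) powr p + 2 powr p * (s powr (p - r) * \<bar>x\<bar> powr r + \<bar>y\<bar> powr p)"
proof -
  have "\<bar>x + y\<bar> powr p \<le> (2 * max \<bar>x\<bar> \<bar>y\<bar>) powr p"
    using assms by (intro powr_mono2) auto
  also have "\<dots> = 2 powr p * max \<bar>x\<bar> \<bar>y\<bar> powr p"
    by (simp add: powr_mult)
  also have "max \<bar>x\<bar> \<bar>y\<bar> powr p \<le> \<bar>x\<bar> powr p + \<bar>y\<bar> powr p"
    by (auto simp: max_def)
  also have "\<bar>x\<bar> powr p \<le> s powr p + s powr (p - r) * \<bar>x\<bar> powr r"
  proof (cases "\<bar>x\<bar> \<le> s")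
    case True
    then have "\<bar>x\<bar> powr p \<le> s powr p"
      using assms by (intro powr_mono2) auto
    then show ?thesis by (simp add: add_increasing2)
  next
    case False
    then have "\<bar>x\<bar> powr (p - r) \<le> s powr (p - r)"
      using assms by (intro powr_mono2') auto
    then have "\<bar>x\<bar> powr (p - r) * \<bar>x\<bar> powr r \<le> s powr (p - r) * \<bar>x\<bar> powr r"
      by (rule mult_right_mono) simp
    then show ?thesis
      by (simp add: add_increasing flip: powr_add)
  qed
  finally show ?thesis
    using assms by (simp add: powr_mult algebra_simps)
qed

text \<open>Since \<open>q < r\<close>, a large \<open>K\<close> brings the first term down to 1/4;
  with \<open>K\<close> fixed, a small \<open>\<gamma>\<close> does the same for the second.\<close>

lemma exists_good_lambda_params:
  fixes p q r A b :: real
  assumes "1 \<le> p" "p < q" "q < r" "A \<ge> 0" "b \<ge> 0"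
  obtains K \<gamma> where "K > 1" "\<gamma> > 0" "A * (b * K powr (- r) + (\<gamma> / K) powr p) * K powr q \<le> 1 / 2"
proof -
  \<comment> \<open>The second entry gives \<open>4 * A * b \<le> K powr (r - q)\<close>; the first
    ensures \<open>K > 1\<close>.\<close>
  define K where "K = max 2 ((4 * A * b + 1) powr (1 / (r - q)))"
  have K: "K > 1" by (simp add: K_def)
  have Ab: "A * b \<ge> 0" using assms by simp
  have "4 * A * b + 1 = ((4 * A * b + 1) powr (1 / (r - q))) powr (r - q)"
    using assms Ab by (simp add: powr_powr)
  also have "\<dots> \<le> K powr (r - q)"
    using assms by (intro powr_mono2) (auto simp: K_def)
  finally have "4 * A * b \<le> K powr (r - q)" by simp
  then have "4 * A * b * (K powr (- r) * K powr q) \<le> K powr (r - q) * (K powr (- r) * K powr q)"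
    by (rule mult_right_mono) simp
  also have "\<dots> = 1"
    using K by (simp flip: powr_add)
  finally have 1: "A * (b * K powr (- r)) * K powr q \<le> 1 / 4" by (simp add: mult_ac)
  \<comment> \<open>Solves \<open>A * (\<gamma> / K) powr p * K powr q = A / (4 * (A + 1))\<close>;
    the summand 1 guards against \<open>A = 0\<close>.\<close>
  define \<gamma> where "\<gamma> = K * (1 / (4 * (A + 1) * K powr q)) powr (1 / p)"
  have pos: "1 / (4 * (A + 1) * K powr q) > 0"
    using assms K by simp
  have \<gamma>: "\<gamma> > 0"
    unfolding \<gamma>_def using K pos by (intro mult_pos_pos) (auto simp only: powr_gt_zero)
  have "(\<gamma> / K) powr p = 1 / (4 * (A + 1) * K powr q)"
    using K pos assms(1) by (simp add: \<gamma>_def powr_powr)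
  then have "A * (\<gamma> / K) powr p * K powr q = A / (4 * (A + 1))"
    using K by simp
  also have "\<dots> \<le> 1 / 4"
    using assms by (simp add: field_simps)
  finally have 2: "A * (\<gamma> / K) powr p * K powr q \<le> 1 / 4" .
  show thesis
    using K \<gamma> 1 2 by (intro that[of K \<gamma>]) (auto simp: algebra_simps)
qed

text \<open>For \<open>t powr q * m t\<close> the hypothesis \<open>step\<close> is a contraction by
  1/2 with a bounded error. The a priori bound \<open>L\<close> settles the heights up to
  \<open>K * t0\<close>, and every larger height is reached from there by multiplications with
  \<open>K\<close>.\<close>

lemma good_lambda_iteration:
  fixes m :: "real \<Rightarrow> real"
  assumes K: "K > 1" and t0: "t0 > 0" and q: "q > 0" and L: "L \<ge> 0" and B: "B \<ge> 0" and \<epsilon>: "\<epsilon> \<ge> 0" "\<epsilon> * K powr q \<le> 1 / 2"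
    and m: "\<And>t. m t \<le> L"
    and step: "\<And>t. t \<ge> t0 \<Longrightarrow> m (K * t) \<le> \<epsilon> * m t + B * t0 powr q * L / t powr q"
    and t: "t \<ge> t0"
  shows "t powr q * m t \<le> (1 + 2 * B) * K powr q * t0 powr q * L"
proof -
  have Kq: "K powr q \<ge> 1"
    using K q by (simp add: ge_one_powr_ge_zero)
  let ?M = "(1 + 2 * B) * K powr q * t0 powr q * L"
  have bound: "t powr q * m t \<le> ?M" if "t0 \<le> t" "t \<le> K ^ N * t0" for N t
    using that
  proof (induction N arbitrary: t)
    case 0
    then have "t powr q * m t \<le> t0 powr q * L"
      using m t0 by (simp add: mult_left_mono)
    also have "t0 powr q * L = 1 * (t0 powr q * L)" by simp
    also have "\<dots> \<le> ((1 + 2 * B) * K powr q) * (t0 powr q * L)"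
      using mult_mono[of 1 "1 + 2 * B" 1 "K powr q"] Kq B L by (intro mult_right_mono) auto
    finally show ?case by (simp add: mult_ac)
  next
    case (Suc N)
    show ?case
    proof (cases "t \<le> K * t0")
      case True
      then have "t powr q * m t \<le> (K * t0) powr q * L"
        using m t0 q K L Suc.prems by (intro order_trans[OF mult_left_mono[OF m] mult_right_mono] powr_mono2) auto
      also have "\<dots> = 1 * (K powr q * t0 powr q * L)"
        using K t0 by (simp add: powr_mult)
      also have "\<dots> \<le> (1 + 2 * B) * (K powr q * t0 powr q * L)"
        using B L by (intro mult_right_mono) auto
      finally show ?thesis by (simp add: mult_ac)
    next
      case False
      \<comment> \<open>One step back on the geometric scale, to a height covered by the induction
        hypothesis.\<close>
      define s where "s = t / K"
      have s: "t = K * s" "t0 \<le> s" "s \<le> K ^ N * t0" "s > 0"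
        using False K Suc.prems t0 by (auto simp: s_def field_simps)
      have IH: "s powr q * m s \<le> ?M"
        using Suc.IH s by blast
      have "t powr q * m t \<le> t powr q * (\<epsilon> * m s + B * t0 powr q * L / s powr q)"
        using step[OF s(2)] s(1) by (intro mult_left_mono) auto
      also have "\<dots> = (\<epsilon> * K powr q) * (s powr q * m s) + B * K powr q * t0 powr q * L"
        using s K by (simp add: powr_mult field_simps)
      also have "\<dots> \<le> (\<epsilon> * K powr q) * ?M + B * K powr q * t0 powr q * L"
        using IH \<epsilon> K by (intro add_right_mono mult_left_mono) auto
      also have "\<dots> \<le> (1 / 2) * ?M + B * K powr q * t0 powr q * L"
        using \<epsilon> B L by (intro add_right_mono mult_right_mono) auto
      \<comment> \<open>After removing the common factor this is
        \<open>(1 + 2 * B) / 2 + B \<le> 1 + 2 * B\<close>, the reason for the form of the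
        constant.\<close>
      also have "\<dots> \<le> ?M"
        using L K t0 by (simp add: algebra_simps)
      finally show ?thesis .
    qed
  qed
  obtain N where "t / t0 < K ^ N"
    using real_arch_pow[OF K] by blast
  then have "t \<le> K ^ N * t0"
    using t0 by (simp add: field_simps)
  with bound t show ?thesis by blast
qed

section \<open>The good-lambda inequality\<close>

lemma ennreal_scale_cancel:
  assumes "0 < y" "0 \<le> e" "ennreal y * m \<le> ennreal (y * e) * n"
  shows "m \<le> ennreal e * n"
proof -
  have "ennreal y * m \<le> ennreal y * (ennreal e * n)"
    using assms by (simp add: ennreal_mult mult.assoc)
  then show ?thesis
    using assms(1) by (subst (asm) ennreal_mult_le_mult_iff) auto
qed

text \<open>The half can be subtracted because \<open>ennreal A * ennreal y\<close> is finite; for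
  infinite \<open>m\<close> the claim is trivial.\<close>

lemma ennreal_absorb_half:
  assumes "0 \<le> A" "0 \<le> y" "ennreal A * ennreal y \<le> ennreal (A / 2) * ennreal y + m"
  shows "ennreal (A / 2) * ennreal y \<le> m"
proof (cases m)
  case (real z)
  have "ennreal (A * y) \<le> ennreal (A / 2 * y + z)"
    using assms real(1) unfolding real(2)
    by (simp add: ennreal_mult[symmetric] ennreal_plus[symmetric] del: ennreal_plus)
  then have "A * y \<le> A / 2 * y + z"
    using assms real(1) by (subst (asm) ennreal_le_iff) auto
  then show ?thesis
    using assms real by (simp add: ennreal_mult[symmetric] ennreal_leI)
qed simp

text \<open>What the argument uses of the operators. Here \<open>h\<close> plays the role of B_Q f,
  \<open>u R\<close> of A_R h and \<open>v R\<close> of B_R f; \<open>c\<close> comes from condition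
  (c). The height \<open>t0\<close> is only required to dominate a(2Q), so that it stays positive
  when a(2Q) vanishes.\<close>

locale good_lambda =
  fixes Q :: "'n::finite cube" and h :: "real^'n \<Rightarrow> real" and u v :: "'n cube \<Rightarrow> real^'n \<Rightarrow> real"
    and a :: "'n cube \<Rightarrow> real" and p q r c D t0 :: real
  assumes Q: "is_cube Q" and h_meas [measurable]: "h \<in> borel_measurable lebesgue"
    and exps: "1 \<le> p" "p < q" "q < r" and c: "c \<ge> 0" and t0: "t0 > 0"
    and u_meas: "\<And>R. is_cube R \<Longrightarrow> u R \<in> borel_measurable lebesgue"
    and v_meas: "\<And>R. is_cube R \<Longrightarrow> v R \<in> borel_measurable lebesgue"
    and decomp: "\<And>R. is_cube R \<Longrightarrow> cube_set R \<subseteq> cube_set Q \<Longrightarrow>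
      AE x in lebesgue. x \<in> cube_set (scale_cube 2 R) \<longrightarrow> h x = u R x + v R x"
    and u_bound: "\<And>R T. is_cube R \<Longrightarrow> cube_set R \<subseteq> cube_set Q \<Longrightarrow> T \<ge> 0 \<Longrightarrow>
      avg_le p h (cube_set (scale_cube 2 R)) T \<Longrightarrow> avg_le r (u R) (cube_set (scale_cube 2 R)) (c * T)"
    and v_bound: "\<And>R. is_cube R \<Longrightarrow> cube_set R \<subseteq> cube_set Q \<Longrightarrow>
      avg_le p (v R) (cube_set (scale_cube 2 R)) (a (scale_cube 2 R))"
    and a_nonneg: "\<And>R. is_cube R \<Longrightarrow> a R \<ge> 0"
    and Dq: "Dq_const q D a"
    and h_avg: "avg_le p h (cube_set (scale_cube 2 Q)) t0"
    and a_le: "a (scale_cube 2 Q) \<le> t0"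
begin

section \<open>Level sets of the dyadic maximal function\<close>

abbreviation \<mu> :: "(real^'n) set \<Rightarrow> ennreal" where "\<mu> \<equiv> emeasure lebesgue"

abbreviation dbl :: "'n cube \<Rightarrow> (real^'n) set" where "dbl R \<equiv> cube_set (scale_cube 2 R)"

definition Big :: "real \<Rightarrow> 'n cube \<Rightarrow> bool" where
  "Big t R \<longleftrightarrow> \<not> avg_le p h (dbl R) t"

text \<open>A level set of the dyadic maximal function of \<open>h\<close>, with averages over the
  doubled cubes because the local bounds are given there.\<close>

definition Om :: "real \<Rightarrow> (real^'n) set" where
  "Om t = (\<Union>R\<in>stopping Q (Big t). cube_set R)"

lemma Om_eq: "Om t = {x \<in> cube_set Q. \<exists>k. Big t (dyadic_cube Q k x)}"
  unfolding Om_def by (rule Union_stopping[OF Q])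

lemma Om_sets [measurable, simp]: "Om t \<in> sets lebesgue"
  unfolding Om_def using Q by simp

lemma Om_subset: "Om t \<subseteq> cube_set Q"
  by (auto simp: Om_eq)

lemma Big_antimono: "0 \<le> s \<Longrightarrow> s \<le> t \<Longrightarrow> Big t R \<Longrightarrow> Big s R"
  using avg_le_mono[of p h _ s t] exps by (auto simp: Big_def)

text \<open>The parent of a selected cube fails the selection; its double contains the double of the
  cube and is 2^n times as large, n the dimension, so the \<open>p\<close>-average grows by at most
  2^(n/p).\<close>

lemma stopping_avg:
  assumes R: "R \<in> stopping Q (Big t)" and t: "t \<ge> t0"
  shows "avg_le p h (dbl R) (2 powr (CARD('n) / p) * t)"
proof -
  obtain k x where R_eq: "R = dyadic_cube Q k x" and x: "x \<in> cube_set Q" "Big t (dyadic_cube Q k x)"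
    "\<And>j. j < k \<Longrightarrow> \<not> Big t (dyadic_cube Q j x)"
    using R by (auto simp: stopping_def)
  \<comment> \<open>A parent exists: \<open>Q\<close> itself is never selected at a height above
    \<open>t0\<close>.\<close>
  have "k \<noteq> 0"
  proof
    assume "k = 0"
    then have "Big t Q" using x dyadic_cube_0[OF Q] by simp
    then have "Big t0 Q" using t t0 by (intro Big_antimono[of t0 t]) auto
    then show False using h_avg by (simp add: Big_def)
  qed
  then obtain j where k: "k = Suc j" by (cases k) auto
  define R' where "R' = dyadic_cube Q j x"
  have R': "is_cube R'" "is_cube R" "cube_set R \<subseteq> cube_set R'" "snd R' = 2 * snd R"
    using Q dyadic_cube_Suc_subset[OF Q] by (auto simp: R'_def R_eq k)
  have pos: "snd R > 0" using R' by (simp add: is_cube_def)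
  have tpos: "t > 0" using t t0 by simp
  have "(\<integral>\<^sup>+x\<in>dbl R. ennreal (\<bar>h x\<bar> powr p) \<partial>lebesgue) \<le> (\<integral>\<^sup>+x\<in>dbl R'. ennreal (\<bar>h x\<bar> powr p) \<partial>lebesgue)"
    using scale_cube_mono[OF R'(2,3), of 2] by (intro nn_integral_mono) (auto simp: indicator_def)
  also have "\<dots> \<le> ennreal (t powr p) * \<mu> (dbl R')"
    using x(3)[of j] by (simp add: k Big_def avg_le_def R'_def)
  also have "\<mu> (dbl R') = ennreal (2 ^ CARD('n)) * \<mu> (dbl R)"
  proof -
    have "\<mu> (dbl R') = ennreal (2 ^ CARD('n) * (2 * snd R) ^ CARD('n))"
    proof -
      have "snd (scale_cube 2 R') = 2 * (2 * snd R)" by (simp add: R'(4))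
      then have "snd (scale_cube 2 R') ^ CARD('n) = 2 ^ CARD('n) * (2 * snd R) ^ CARD('n)"
        by (simp only: power_mult_distrib)
      then show ?thesis
        using pos R'(4) by (subst emeasure_cube_set) auto
    qed
    also have "\<dots> = ennreal (2 ^ CARD('n)) * ennreal ((2 * snd R) ^ CARD('n))"
      using pos by (intro ennreal_mult) auto
    also have "ennreal ((2 * snd R) ^ CARD('n)) = \<mu> (dbl R)"
      using pos by (subst emeasure_cube_set) auto
    finally show ?thesis .
  qed
  also have "ennreal (t powr p) * (ennreal (2 ^ CARD('n)) * \<mu> (dbl R))
     = ennreal ((2 powr (CARD('n) / p) * t) powr p) * \<mu> (dbl R)"
    using tpos exps by (simp add: powr_mult powr_powr powr_realpow ennreal_mult mult_ac)
  finally show ?thesis by (simp add: avg_le_def)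
qed

text \<open>On the doubles where the average of \<open>h\<close> exceeds \<open>K * t\<close>, at
  most half of the excess is due to the constant in \<open>powr_add_le\<close>. The rest is carried
  by a density \<open>g\<close> whose mass on 2R is bounded through \<open>u\<close> and
  \<open>v\<close>, and \<open>weak_type_cubes\<close> applies to it.\<close>

lemma level_set_in_stopping_cube:
  assumes R: "R \<in> stopping Q (Big t)" and t: "t \<ge> t0" and K: "K > 1"
  shows "ennreal ((K * t) powr p / 2) * \<mu> (Om (K * t) \<inter> cube_set R)
    \<le> ennreal (vitali_const TYPE('n) * 2 ^ CARD('n) * 2 powr p *
        ((K * t / 4) powr (p - r) * (c * (2 powr (CARD('n) / p) * t)) powr r + a (scale_cube 2 R) powr p))
      * \<mu> (cube_set R)"
proof -
  let ?X = "Om (K * t) \<inter> cube_set R"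
  \<comment> \<open>With this value the constant \<open>(2 * s) powr p\<close> is at most half of
    \<open>(K * t) powr p\<close>, as \<open>p\<close> is at least 1.\<close>
  define s where "s = K * t / 4"
  have tpos: "t > 0" using t t0 by simp
  have s: "s > 0" using tpos K by (simp add: s_def)
  have Rc: "is_cube R" and RQ: "cube_set R \<subseteq> cube_set Q"
    using stopping_subset[OF Q R] by auto
  note [measurable] = u_meas[OF Rc] v_meas[OF Rc]
  define g where "g x = ennreal (2 powr p * (s powr (p - r) * \<bar>u R x\<bar> powr r + \<bar>v R x\<bar> powr p))" for x
  have g [measurable]: "g \<in> borel_measurable lebesgue"
    unfolding g_def by measurable
  let ?\<nu> = "density lebesgue g"
  define F where "F = {S. \<exists>k x. S = scale_cube 2 (dyadic_cube Q k x) \<and> Big (K * t) (dyadic_cube Q k x) \<and> cube_set (dyadic_cube Q k x) \<subseteq> cube_set R}"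
  have "(2 * s) powr p = (K * t) powr p / 2 powr p"
    using K tpos by (simp add: s_def powr_divide[symmetric])
  also have "\<dots> \<le> (K * t) powr p / 2"
    using exps powr_mono[of 1 p 2] by (intro divide_left_mono) auto
  finally have s_le: "(2 * s) powr p \<le> (K * t) powr p / 2" .
  have "ennreal ((K * t) powr p / 2) * \<mu> ?X \<le> ennreal (vitali_const TYPE('n)) * emeasure ?\<nu> (dbl R)"
  proof (rule weak_type_cubes[where F = F and b = "2 * snd Q"])
    show "0 < snd S \<and> snd S \<le> 2 * snd Q" if SF: "S \<in> F" for S
    proof -
      obtain k x where S: "S = scale_cube 2 (dyadic_cube Q k x)" using SF unfolding F_def by blast
      have "snd Q / 2 ^ k \<le> snd Q / 1"
        using Q by (intro divide_left_mono) (auto simp: is_cube_def)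
      then show ?thesis using Q by (simp add: S is_cube_def)
    qed
    show "?X \<subseteq> (\<Union>S\<in>F. cube_set S)"
    proof
      fix x assume x: "x \<in> ?X"
      then obtain k where k: "Big (K * t) (dyadic_cube Q k x)" by (auto simp: Om_eq)
      obtain m z where R_eq: "R = dyadic_cube Q m z" and z: "\<And>j. j < m \<Longrightarrow> \<not> Big t (dyadic_cube Q j z)"
        using R by (auto simp: stopping_def)
      have eq: "dyadic_cube Q j x = dyadic_cube Q j z" if "j \<le> m" for j
        using dyadic_cube_eq_le[OF Q that] x R_eq by blast
      \<comment> \<open>A cube selected at height \<open>K * t\<close> is also big at height
        \<open>t\<close>; were it strictly larger than \<open>R\<close>, it would contradict the
        maximality of \<open>R\<close>.\<close>
      have "m \<le> k"
      proof (rule ccontr)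
        assume "\<not> m \<le> k"
        then have "\<not> Big t (dyadic_cube Q k x)" using z[of k] eq[of k] by simp
        moreover have "Big t (dyadic_cube Q k x)"
          using k K tpos by (intro Big_antimono[OF _ _ k]) auto
        ultimately show False by simp
      qed
      then have "cube_set (dyadic_cube Q k x) \<subseteq> cube_set R"
        using dyadic_cube_antimono[OF Q, of m k x] eq[of m] R_eq by simp
      then have "scale_cube 2 (dyadic_cube Q k x) \<in> F"
        using k unfolding F_def by blast
      moreover have "x \<in> cube_set (scale_cube 2 (dyadic_cube Q k x))"
        using self_mem_dyadic_cube[OF Q, of x k] cube_subset_double[of "dyadic_cube Q k x"] Q by auto
      ultimately show "x \<in> (\<Union>S\<in>F. cube_set S)" by blast
    qed
    show "cube_set S \<subseteq> dbl R \<and> ennreal ((K * t) powr p / 2) * \<mu> (cube_set S) \<le> emeasure ?\<nu> (cube_set S)"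
      if SF: "S \<in> F" for S
    proof -
      obtain k x where S: "S = scale_cube 2 (dyadic_cube Q k x)" and big: "Big (K * t) (dyadic_cube Q k x)"
        and sub: "cube_set (dyadic_cube Q k x) \<subseteq> cube_set R"
        using SF unfolding F_def by blast
      have SR: "cube_set S \<subseteq> dbl R"
        unfolding S using sub Q by (intro scale_cube_mono) auto
      have pw: "AE y in lebesgue. ennreal (\<bar>h y\<bar> powr p) * indicator (cube_set S) y \<le>
         ennreal ((2 * s) powr p) * indicator (cube_set S) y + g y * indicator (cube_set S) y"
        using decomp[OF Rc RQ]
      proof eventually_elim
        case (elim y)
        show ?case
        proof (cases "y \<in> cube_set S")
          case True
          then have "h y = u R y + v R y" using elim SR by blast
          then have "\<bar>h y\<bar> powr p \<le> (2 * s) powr p + 2 powr p * (s powr (p - r) * \<bar>u R y\<bar> powr r + \<bar>v R y\<bar> powr p)"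
            using powr_add_le[of p r s "u R y" "v R y"] exps s by simp
          then have "ennreal (\<bar>h y\<bar> powr p) \<le> ennreal ((2 * s) powr p) + g y"
            unfolding g_def by (subst ennreal_plus[symmetric]) (auto intro: ennreal_leI simp del: ennreal_plus)
          then show ?thesis using True by simp
        qed simp
      qed
      have "ennreal ((K * t) powr p) * \<mu> (cube_set S) \<le> (\<integral>\<^sup>+y\<in>cube_set S. ennreal (\<bar>h y\<bar> powr p) \<partial>lebesgue)"
        using big unfolding Big_def avg_le_def S by simp
      also have "\<dots> \<le> (\<integral>\<^sup>+y. ennreal ((2 * s) powr p) * indicator (cube_set S) y + g y * indicator (cube_set S) y \<partial>lebesgue)"
        by (rule nn_integral_mono_AE[OF pw])
      also have "\<dots> = ennreal ((2 * s) powr p) * \<mu> (cube_set S) + emeasure ?\<nu> (cube_set S)"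
        by (subst nn_integral_add) (auto simp: nn_integral_cmult_indicator emeasure_density)
      also have "\<dots> \<le> ennreal ((K * t) powr p / 2) * \<mu> (cube_set S) + emeasure ?\<nu> (cube_set S)"
        using s_le by (intro add_right_mono mult_right_mono ennreal_leI) auto
      finally have le: "ennreal ((K * t) powr p) * \<mu> (cube_set S) \<le>
         ennreal ((K * t) powr p / 2) * \<mu> (cube_set S) + emeasure ?\<nu> (cube_set S)" .
      obtain y where y: "y \<ge> 0" "\<mu> (cube_set S) = ennreal y"
      proof
        have "0 \<le> snd S"
          using Q by (simp add: S is_cube_def)
        then show "0 \<le> snd S ^ CARD('n)" "\<mu> (cube_set S) = ennreal (snd S ^ CARD('n))"
          by (simp_all only: zero_le_power emeasure_cube_set)
      qed
      have "ennreal ((K * t) powr p / 2) * \<mu> (cube_set S) \<le> emeasure ?\<nu> (cube_set S)"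
        using le y(1) unfolding y(2) by (intro ennreal_absorb_half) auto
      then show ?thesis using SR by simp
    qed
  qed auto
  also have "emeasure ?\<nu> (dbl R) \<le> ennreal (2 powr p *
      (s powr (p - r) * (c * (2 powr (CARD('n) / p) * t)) powr r + a (scale_cube 2 R) powr p)) * \<mu> (dbl R)"
  proof -
    \<comment> \<open>By \<open>stopping_avg\<close> this height bounds the average of
      \<open>h\<close> over 2R, so \<open>u_bound\<close> can be used with it.\<close>
    let ?T = "2 powr (CARD('n) / p) * t"
    have ub: "(\<integral>\<^sup>+x\<in>dbl R. ennreal (\<bar>u R x\<bar> powr r) \<partial>lebesgue) \<le> ennreal ((c * ?T) powr r) * \<mu> (dbl R)"
      using u_bound[OF Rc RQ _ stopping_avg[OF R t]] tpos by (simp add: avg_le_def)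
    have vb: "(\<integral>\<^sup>+x\<in>dbl R. ennreal (\<bar>v R x\<bar> powr p) \<partial>lebesgue) \<le> ennreal (a (scale_cube 2 R) powr p) * \<mu> (dbl R)"
      using v_bound[OF Rc RQ] by (simp add: avg_le_def)
    have "emeasure ?\<nu> (dbl R) = (\<integral>\<^sup>+x. ennreal (2 powr p) * (ennreal (s powr (p - r)) * (ennreal (\<bar>u R x\<bar> powr r) * indicator (dbl R) x)
        + ennreal (\<bar>v R x\<bar> powr p) * indicator (dbl R) x) \<partial>lebesgue)"
      by (subst emeasure_density) (auto simp: g_def ennreal_mult indicator_def intro!: nn_integral_cong)
    also have "\<dots> = ennreal (2 powr p) * (ennreal (s powr (p - r)) * (\<integral>\<^sup>+x\<in>dbl R. ennreal (\<bar>u R x\<bar> powr r) \<partial>lebesgue)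
        + (\<integral>\<^sup>+x\<in>dbl R. ennreal (\<bar>v R x\<bar> powr p) \<partial>lebesgue))"
      by (simp add: nn_integral_cmult nn_integral_add)
    also have "\<dots> \<le> ennreal (2 powr p) * (ennreal (s powr (p - r)) * (ennreal ((c * ?T) powr r) * \<mu> (dbl R))
        + ennreal (a (scale_cube 2 R) powr p) * \<mu> (dbl R))"
      by (intro mult_left_mono add_mono ub vb) auto
    also have "\<dots> = ennreal (2 powr p * (s powr (p - r) * (c * ?T) powr r + a (scale_cube 2 R) powr p)) * \<mu> (dbl R)"
      by (simp add: ennreal_mult algebra_simps)
    finally show ?thesis .
  qed
  also have "\<mu> (dbl R) = ennreal (2 ^ CARD('n)) * \<mu> (cube_set R)"
    by (rule emeasure_double_cube[OF Rc])
  finally have "ennreal ((K * t) powr p / 2) * \<mu> ?X \<le> ennreal (vitali_const TYPE('n)) * (ennreal (2 powr p *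
      (s powr (p - r) * (c * (2 powr (CARD('n) / p) * t)) powr r + a (scale_cube 2 R) powr p)) *
      (ennreal (2 ^ CARD('n)) * \<mu> (cube_set R)))"
    by (simp add: mult_left_mono)
  also have "\<dots> = ennreal (vitali_const TYPE('n) * 2 ^ CARD('n) * 2 powr p *
        (s powr (p - r) * (c * (2 powr (CARD('n) / p) * t)) powr r + a (scale_cube 2 R) powr p))
      * \<mu> (cube_set R)"
    using vitali_const_pos[where 'n='n] by (simp add: ennreal_mult mult_ac)
  finally show ?thesis by (simp add: s_def)
qed

text \<open>When a(2R) is at most \<open>\<gamma> * t\<close>, all powers of \<open>t\<close> cancel
  and the proportion depends only on \<open>K\<close>, \<open>\<gamma>\<close> and fixed
  constants.\<close>

lemma level_set_in_good_cube:
  assumes R: "R \<in> stopping Q (Big t)" and t: "t \<ge> t0" and K: "K > 1" and \<gamma>: "\<gamma> > 0" "a (scale_cube 2 R) \<le> \<gamma> * t"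
  shows "\<mu> (Om (K * t) \<inter> cube_set R) \<le>
    ennreal (2 * vitali_const TYPE('n) * 2 ^ CARD('n) * 2 powr p *
      (4 powr (r - p) * (c * 2 powr (CARD('n) / p)) powr r * K powr (- r) + (\<gamma> / K) powr p)) * \<mu> (cube_set R)"
    (is "?m \<le> ennreal ?\<epsilon> * ?R")
proof -
  have tpos: "t > 0" using t t0 by simp
  have Vpos: "vitali_const TYPE('n) > 0" by (rule vitali_const_pos)
  have "a (scale_cube 2 R) powr p \<le> (\<gamma> * t) powr p"
    using \<gamma> exps a_nonneg stopping_subset(2)[OF Q R] by (intro powr_mono2) auto
  then have "vitali_const TYPE('n) * 2 ^ CARD('n) * 2 powr p *
        ((K * t / 4) powr (p - r) * (c * (2 powr (CARD('n) / p) * t)) powr r + a (scale_cube 2 R) powr p)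
    \<le> vitali_const TYPE('n) * 2 ^ CARD('n) * 2 powr p *
        ((K * t / 4) powr (p - r) * (c * (2 powr (CARD('n) / p) * t)) powr r + (\<gamma> * t) powr p)"
    using Vpos by (intro mult_left_mono) auto
  also have "\<dots> = (K * t) powr p / 2 * ?\<epsilon>"
  proof -
    have 1: "(K * t / 4) powr (p - r) = (K * t) powr p * 4 powr (r - p) * K powr (- r) * t powr (- r)"
      using K tpos by (simp add: powr_divide powr_mult powr_diff powr_minus field_simps)
    have 2: "(c * (2 powr (CARD('n) / p) * t)) powr r = (c * 2 powr (CARD('n) / p)) powr r * t powr r"
      using c tpos by (simp add: powr_mult mult_ac)
    have 3: "(\<gamma> * t) powr p = (K * t) powr p * (\<gamma> / K) powr p"
      using K \<gamma> tpos by (simp add: powr_mult powr_divide)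
    have 4: "t powr (- r) * t powr r = 1"
      using tpos by (simp flip: powr_add)
    show ?thesis
      unfolding 1 2 3 using 4 by (simp add: algebra_simps)
  qed
  finally have "ennreal (vitali_const TYPE('n) * 2 ^ CARD('n) * 2 powr p *
        ((K * t / 4) powr (p - r) * (c * (2 powr (CARD('n) / p) * t)) powr r + a (scale_cube 2 R) powr p)) * ?R
     \<le> ennreal ((K * t) powr p / 2 * ?\<epsilon>) * ?R"
    by (intro mult_right_mono ennreal_leI) auto
  with level_set_in_stopping_cube[OF R t K] have le: "ennreal ((K * t) powr p / 2) * ?m \<le> ennreal ((K * t) powr p / 2 * ?\<epsilon>) * ?R"
    by (rule order_trans)
  have e: "?\<epsilon> \<ge> 0" using Vpos by simp
  have pos: "(K * t) powr p / 2 > 0" using K tpos by simp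
  show ?thesis
    by (rule ennreal_scale_cancel[OF pos e le])
qed

text \<open>The selected cubes are disjoint but their doubles may overlap, so Vitali first extracts
  disjoint doubles. These lie in 2Q, where D_q bounds the sum, and Chebyshev's inequality gives the
  measure.\<close>

lemma measure_bad_cubes:
  assumes t: "t \<ge> t0" and \<gamma>: "\<gamma> > 0"
  shows "ennreal ((\<gamma> * t) powr q) * \<mu> (\<Union>R\<in>{R \<in> stopping Q (Big t). a (scale_cube 2 R) > \<gamma> * t}. cube_set R)
    \<le> ennreal (vitali_const TYPE('n) * D powr q * t0 powr q * 2 ^ CARD('n)) * \<mu> (cube_set Q)"
proof -
  let ?X = "\<Union>R\<in>{R \<in> stopping Q (Big t). a (scale_cube 2 R) > \<gamma> * t}. cube_set R"
  define F where "F = scale_cube 2 ` {R \<in> stopping Q (Big t). a (scale_cube 2 R) > \<gamma> * t}"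
  have F: "is_cube S \<and> cube_set S \<subseteq> dbl Q \<and> a S > \<gamma> * t" if "S \<in> F" for S
  proof -
    obtain R where R: "S = scale_cube 2 R" "R \<in> stopping Q (Big t)" "a (scale_cube 2 R) > \<gamma> * t"
      using \<open>S \<in> F\<close> by (auto simp: F_def)
    have "is_cube R" "cube_set R \<subseteq> cube_set Q"
      using stopping_subset[OF Q R(2)] by auto
    with R show ?thesis
      using scale_cube_mono[of R Q 2] by simp
  qed
  have Fsz: "0 < snd S \<and> snd S \<le> 2 * snd Q" if "S \<in> F" for S
    using F[OF that] snd_mono_cube[of S "scale_cube 2 Q"] by (simp add: is_cube_def)
  have X: "?X \<subseteq> (\<Union>S\<in>F. cube_set S)"
  proof
    fix x assume "x \<in> ?X"
    then obtain R where R: "R \<in> stopping Q (Big t)" "a (scale_cube 2 R) > \<gamma> * t" "x \<in> cube_set R" by auto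
    then have "x \<in> dbl R"
      using cube_subset_double[of R] stopping_subset(2)[OF Q R(1)] by blast
    with R show "x \<in> (\<Union>S\<in>F. cube_set S)" unfolding F_def by blast
  qed
  obtain G where G: "countable G" "G \<subseteq> F" "disjoint_family_on cube_set G"
    "\<mu> ?X \<le> ennreal (vitali_const TYPE('n)) * (\<integral>\<^sup>+S. \<mu> (cube_set S) \<partial>count_space G)"
    using Vitali_cubes[OF Fsz X] by blast
  have tpos: "t > 0" using t t0 by simp
  \<comment> \<open>D_q is used on finite subfamilies, where its sum is an ordinary one;
    \<open>nn_integral_count_space_le\<close> then passes to the whole of \<open>G\<close>.\<close>
  have fin: "(\<Sum>S\<in>H. ennreal (a S powr q) * \<mu> (cube_set S)) \<le> ennreal (D powr q * a (scale_cube 2 Q) powr q) * \<mu> (dbl Q)"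
    if H: "finite H" "H \<subseteq> G" for H
  proof -
    have "(\<Sum>\<^sub>\<infinity>S\<in>H. ennreal (a S powr q) * \<mu> (cube_set S)) \<le> ennreal (D powr q * a (scale_cube 2 Q) powr q) * \<mu> (dbl Q)"
    proof -
      have "is_cube (scale_cube 2 Q)" using Q by simp
      moreover have "\<forall>R\<in>H. is_cube R \<and> cube_set R \<subseteq> dbl Q"
        using H(2) G(2) F by blast
      moreover have "\<forall>R\<in>H. \<forall>S\<in>H. R \<noteq> S \<longrightarrow> cube_set R \<inter> cube_set S = {}"
        using H(2) G(3) unfolding disjoint_family_on_def by blast
      ultimately show ?thesis
        using Dq unfolding Dq_const_def by blast
    qed
    then show ?thesis using H(1) by simp
  qed
  have "ennreal ((\<gamma> * t) powr q) * \<mu> ?X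
     \<le> ennreal ((\<gamma> * t) powr q) * (ennreal (vitali_const TYPE('n)) * (\<integral>\<^sup>+S. \<mu> (cube_set S) \<partial>count_space G))"
    using G(4) by (rule mult_left_mono) simp
  also have "\<dots> = ennreal (vitali_const TYPE('n)) * (\<integral>\<^sup>+S. ennreal ((\<gamma> * t) powr q) * \<mu> (cube_set S) \<partial>count_space G)"
    by (subst nn_integral_cmult) (auto simp: mult.left_commute)
  also have "\<dots> \<le> ennreal (vitali_const TYPE('n)) * (\<integral>\<^sup>+S. ennreal (a S powr q) * \<mu> (cube_set S) \<partial>count_space G)"
  proof (intro mult_left_mono nn_integral_mono mult_right_mono ennreal_leI powr_mono2)
    fix S assume "S \<in> space (count_space G)"
    then have "S \<in> F" using G(2) by auto
    then show "\<gamma> * t \<le> a S" using F by (simp only: less_imp_le)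
  qed (use exps tpos \<gamma> in auto)
  also have "\<dots> \<le> ennreal (vitali_const TYPE('n)) * (ennreal (D powr q * a (scale_cube 2 Q) powr q) * \<mu> (dbl Q))"
    using G(1) fin by (intro mult_left_mono nn_integral_count_space_le) auto
  also have "\<dots> \<le> ennreal (vitali_const TYPE('n)) * (ennreal (D powr q * t0 powr q) * \<mu> (dbl Q))"
    using a_le a_nonneg[of "scale_cube 2 Q"] Q exps
    by (intro mult_left_mono mult_right_mono ennreal_leI powr_mono2) auto
  also have "\<mu> (dbl Q) = ennreal (2 ^ CARD('n)) * \<mu> (cube_set Q)"
    by (rule emeasure_double_cube[OF Q])
  also have "ennreal (vitali_const TYPE('n)) * (ennreal (D powr q * t0 powr q) * \<dots>) = 
     ennreal (vitali_const TYPE('n) * D powr q * t0 powr q * 2 ^ CARD('n)) * \<mu> (cube_set Q)"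
    using vitali_const_pos[where 'n='n] by (simp add: ennreal_mult mult_ac)
  finally show ?thesis .
qed

lemma Om_finite: "\<mu> (Om t) < top"
proof -
  have "\<mu> (Om t) \<le> \<mu> (cube_set Q)" using Om_subset by (intro emeasure_mono) auto
  also have "\<dots> < top"
    using Q by (subst emeasure_cube_set) (auto simp: is_cube_def)
  finally show ?thesis .
qed

text \<open>The selected cubes at height \<open>t\<close> cover the level set at height
  \<open>K * t\<close>. On good ones the smaller level set occupies a fraction
  \<open>\<epsilon>\<close>; bad ones are counted in full.\<close>

lemma good_lambda_inequality:
  assumes t: "t \<ge> t0" and K: "K > 1" and \<gamma>: "\<gamma> > 0"
  defines "\<epsilon> \<equiv> 2 * vitali_const TYPE('n) * 2 ^ CARD('n) * 2 powr p *
      (4 powr (r - p) * (c * 2 powr (CARD('n) / p)) powr r * K powr (- r) + (\<gamma> / K) powr p)"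
  shows "measure lebesgue (Om (K * t)) \<le> \<epsilon> * measure lebesgue (Om t)
     + (vitali_const TYPE('n) * D powr q * 2 ^ CARD('n) / \<gamma> powr q) * t0 powr q * snd Q ^ CARD('n) / t powr q"
proof -
  have tpos: "t > 0" using t t0 by simp
  have \<epsilon>: "\<epsilon> \<ge> 0" using vitali_const_pos[where 'n='n] by (simp add: \<epsilon>_def)
  let ?S = "stopping Q (Big t)"
  define good where "good = {R \<in> ?S. a (scale_cube 2 R) \<le> \<gamma> * t}"
  define bad where "bad = (\<Union>R\<in>{R \<in> ?S. a (scale_cube 2 R) > \<gamma> * t}. cube_set R)"
  have cg: "countable good" "disjoint_family_on cube_set good"
    using countable_stopping[OF Q] stopping_disjoint[OF Q]
    by (auto simp: good_def intro: countable_subset disjoint_family_on_mono)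
  have bad_sets: "bad \<in> sets lebesgue"
    unfolding bad_def using countable_stopping[OF Q, of "Big t"] by (intro sets.countable_UN'') auto
  have sub: "Om (K * t) \<subseteq> Om t"
  proof -
    have "Big t R" if "Big (K * t) R" for R
      using that tpos K by (intro Big_antimono[of t "K * t"]) auto
    then show ?thesis
      unfolding Om_eq by blast
  qed
  have "Om (K * t) \<subseteq> (\<Union>R\<in>good. Om (K * t) \<inter> cube_set R) \<union> bad"
  proof
    fix x assume x: "x \<in> Om (K * t)"
    then obtain R where "R \<in> ?S" "x \<in> cube_set R"
      using sub unfolding Om_def[of t] by blast
    with x show "x \<in> (\<Union>R\<in>good. Om (K * t) \<inter> cube_set R) \<union> bad"
      unfolding good_def bad_def by (cases "a (scale_cube 2 R) \<le> \<gamma> * t") (blast, force simp only: not_le)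
  qed
  then have "\<mu> (Om (K * t)) \<le> \<mu> ((\<Union>R\<in>good. Om (K * t) \<inter> cube_set R) \<union> bad)"
    using cg(1) bad_sets by (intro emeasure_mono sets.Un sets.countable_UN'') auto
  also have "\<dots> \<le> \<mu> (\<Union>R\<in>good. Om (K * t) \<inter> cube_set R) + \<mu> bad"
    using cg(1) bad_sets by (intro emeasure_subadditive sets.countable_UN'') auto
  also have "\<mu> (\<Union>R\<in>good. Om (K * t) \<inter> cube_set R) \<le> ennreal \<epsilon> * \<mu> (Om t)"
  proof -
    have "\<mu> (\<Union>R\<in>good. Om (K * t) \<inter> cube_set R) \<le> (\<integral>\<^sup>+R. \<mu> (Om (K * t) \<inter> cube_set R) \<partial>count_space good)"
      using cg(1) by (intro emeasure_UN_le_nn_integral) auto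
    also have "\<dots> \<le> (\<integral>\<^sup>+R. ennreal \<epsilon> * \<mu> (cube_set R) \<partial>count_space good)"
      using level_set_in_good_cube[OF _ t K \<gamma>] by (intro nn_integral_mono) (auto simp: \<epsilon>_def good_def)
    also have "\<dots> = ennreal \<epsilon> * (\<integral>\<^sup>+R. \<mu> (cube_set R) \<partial>count_space good)"
      by (simp add: nn_integral_cmult)
    also have "(\<integral>\<^sup>+R. \<mu> (cube_set R) \<partial>count_space good) = \<mu> (\<Union>R\<in>good. cube_set R)"
      using cg by (intro emeasure_UN_countable[symmetric]) auto
    also have "ennreal \<epsilon> * \<dots> \<le> ennreal \<epsilon> * \<mu> (Om t)"
      by (intro mult_left_mono emeasure_mono) (auto simp: Om_def good_def Q)
    finally show ?thesis .
  qed
  finally have main: "\<mu> (Om (K * t)) \<le> ennreal \<epsilon> * \<mu> (Om t) + \<mu> bad"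
    by (simp add: add_right_mono)
  have muQ: "\<mu> (cube_set Q) = ennreal (snd Q ^ CARD('n))"
    using Q by (intro emeasure_cube_set) (simp add: is_cube_def)
  have "bad \<subseteq> cube_set Q"
    using stopping_subset(1)[OF Q] by (auto simp: bad_def)
  then have "\<mu> bad \<le> \<mu> (cube_set Q)" by (intro emeasure_mono) auto
  \<comment> \<open>Finiteness of the measures allows the inequality to be read in the reals, as the
    iteration requires.\<close>
  then obtain b where b: "b \<ge> 0" "\<mu> bad = ennreal b"
    using muQ by (cases "\<mu> bad") (auto simp: top_unique)
  let ?c = "vitali_const TYPE('n) * D powr q * t0 powr q * 2 ^ CARD('n)"
  have c0: "?c \<ge> 0" using vitali_const_pos[where 'n='n] by simp
  have "ennreal ((\<gamma> * t) powr q * b) \<le> ennreal (?c * snd Q ^ CARD('n))"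
    using measure_bad_cubes[OF t \<gamma>] b muQ c0 Q
    by (fold bad_def) (simp only: is_cube_def ennreal_mult less_imp_le zero_le_power powr_ge_zero)
  then have "(\<gamma> * t) powr q * b \<le> ?c * snd Q ^ CARD('n)"
    using c0 Q by (subst (asm) ennreal_le_iff) (auto simp: is_cube_def)
  then have b_le: "b \<le> (vitali_const TYPE('n) * D powr q * 2 ^ CARD('n) / \<gamma> powr q) * t0 powr q * snd Q ^ CARD('n) / t powr q"
    using \<gamma> tpos by (simp add: powr_mult field_simps)
  have fin: "\<mu> (Om s) = ennreal (measure lebesgue (Om s))" for s
    using Om_finite[of s] by (intro emeasure_eq_ennreal_measure) auto
  have "ennreal (measure lebesgue (Om (K * t))) \<le> ennreal (\<epsilon> * measure lebesgue (Om t) + b)"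
    using main b \<epsilon> unfolding fin by (simp add: ennreal_mult)
  then have "measure lebesgue (Om (K * t)) \<le> \<epsilon> * measure lebesgue (Om t) + b"
    using b \<epsilon> by (subst (asm) ennreal_le_iff) auto
  with b_le show ?thesis by linarith
qed

text \<open>Off \<open>Om t\<close> the averages over doubles are at most \<open>t\<close>, hence
  those over the cubes themselves at most 2^(n/p) \<open>t\<close>, n the dimension; by dyadic
  differentiation \<open>h\<close> obeys the same bound almost everywhere there.\<close>

lemma level_set_le_Om:
  assumes t: "t > 0"
  shows "\<mu> {x \<in> cube_set Q. \<bar>h x\<bar> > 2 powr (CARD('n) / p) * t} \<le> \<mu> (Om t)"
proof -
  let ?\<tau> = "2 powr (CARD('n) / p) * t"
  let ?H = "\<lambda>x. ennreal (\<bar>h x\<bar> powr p)"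
  let ?L = "{x \<in> cube_set Q. \<bar>h x\<bar> > ?\<tau>}"
  define N where "N = {x \<in> cube_set Q. ennreal (?\<tau> powr p) < ?H x \<and>
     (\<forall>k. emeasure (density lebesgue ?H) (cube_set (dyadic_cube Q k x)) \<le> ennreal (?\<tau> powr p) * \<mu> (cube_set (dyadic_cube Q k x)))}"
  have L: "?L \<in> sets lebesgue"
  proof -
    have "?L = cube_set Q \<inter> {x \<in> space lebesgue. \<bar>h x\<bar> > ?\<tau>}" by auto
    also have "\<dots> \<in> sets lebesgue"
    proof (intro sets.Int)
      show "{x \<in> space lebesgue. \<bar>h x\<bar> > ?\<tau>} \<in> sets lebesgue" by measurable
    qed simp
    finally show ?thesis .
  qed
  have sub: "?L - Om t \<subseteq> N"
  proof
    fix x assume x: "x \<in> ?L - Om t"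
    have "?\<tau> powr p < \<bar>h x\<bar> powr p"
      using x t exps by (intro powr_less_mono2) auto
    moreover have "emeasure (density lebesgue ?H) (cube_set (dyadic_cube Q k x)) \<le> ennreal (?\<tau> powr p) * \<mu> (cube_set (dyadic_cube Q k x))" for k
    proof -
      have dc: "is_cube (dyadic_cube Q k x)" using Q by simp
      have "emeasure (density lebesgue ?H) (cube_set (dyadic_cube Q k x)) \<le> emeasure (density lebesgue ?H) (dbl (dyadic_cube Q k x))"
        using cube_subset_double[OF dc] by (intro emeasure_mono) auto
      also have "\<dots> \<le> ennreal (t powr p) * \<mu> (dbl (dyadic_cube Q k x))"
        using x by (simp add: Om_eq Big_def avg_le_def emeasure_density)
      also have "\<dots> = ennreal (?\<tau> powr p) * \<mu> (cube_set (dyadic_cube Q k x))"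
        using t exps by (simp only: emeasure_double_cube[OF dc])
          (simp add: powr_mult powr_powr powr_realpow ennreal_mult mult_ac)
      finally show ?thesis .
    qed
    ultimately show "x \<in> N"
      using x t exps by (auto simp: N_def ennreal_less_iff)
  qed
  have "N \<in> null_sets lebesgue"
    unfolding N_def by (intro dyadic_differentiation Q) auto
  then have "?L - Om t \<in> null_sets lebesgue"
    by (rule null_sets_completion_subset[OF sub])
  then have "\<mu> (Om t \<union> (?L - Om t)) = \<mu> (Om t)"
    by (intro emeasure_Un_null_set Om_sets)
  moreover have "\<mu> ?L \<le> \<mu> (Om t \<union> (?L - Om t))"
  proof (rule emeasure_mono)
    show "Om t \<union> (?L - Om t) \<in> sets lebesgue"
      by (intro sets.Un sets.Diff L Om_sets)
  qed blast
  ultimately show ?thesis by (simp only:)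
qed

end

lemma (in good_lambda) distribution_bound:
  assumes K: "K > 1" and \<gamma>: "\<gamma> > 0" and \<tau>: "\<tau> > 0"
    and small: "2 * vitali_const TYPE('n) * 2 ^ CARD('n) * 2 powr p *
      (4 powr (r - p) * (c * 2 powr (CARD('n) / p)) powr r * K powr (- r) + (\<gamma> / K) powr p) * K powr q \<le> 1 / 2"
  shows "ennreal (\<tau> powr q) * \<mu> {x \<in> cube_set Q. \<bar>h x\<bar> > \<tau>} \<le>
    ennreal ((2 powr (CARD('n) / p)) powr q * (1 + 2 * (vitali_const TYPE('n) * D powr q * 2 ^ CARD('n) / \<gamma> powr q)) * K powr q * t0 powr q)
      * \<mu> (cube_set Q)"
proof -
  let ?B = "vitali_const TYPE('n) * D powr q * 2 ^ CARD('n) / \<gamma> powr q"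
  let ?b = "2 powr (CARD('n) / p)"
  let ?L = "snd Q ^ CARD('n)"
  \<comment> \<open>Compensates the factor lost in \<open>level_set_le_Om\<close>.\<close>
  define t where "t = \<tau> / ?b"
  have tpos: "t > 0" and \<tau>_eq: "\<tau> = ?b * t" using \<tau> by (auto simp: t_def)
  have L: "?L \<ge> 0" using Q by (simp add: is_cube_def)
  have muQ: "\<mu> (cube_set Q) = ennreal ?L"
    using Q by (intro emeasure_cube_set) (simp add: is_cube_def)
  have B: "?B \<ge> 0" using vitali_const_pos[where 'n='n] by simp
  have fin: "\<mu> (Om s) = ennreal (measure lebesgue (Om s))" for s
    using Om_finite[of s] by (intro emeasure_eq_ennreal_measure) auto
  have mL: "measure lebesgue (Om s) \<le> ?L" for s
  proof -
    have "\<mu> (Om s) \<le> \<mu> (cube_set Q)"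
      using Om_subset by (intro emeasure_mono) auto
    then show ?thesis
      using L unfolding fin muQ by (subst (asm) ennreal_le_iff) auto
  qed
  have main: "t powr q * measure lebesgue (Om t) \<le> (1 + 2 * ?B) * K powr q * t0 powr q * ?L" if "t \<ge> t0"
  proof (rule good_lambda_iteration[OF K t0 _ L B _ small mL _ that])
    show "q > 0" using exps by simp
  qed (use good_lambda_inequality[OF _ K \<gamma>] vitali_const_pos[where 'n='n] in auto)
  have "ennreal (t powr q) * \<mu> {x \<in> cube_set Q. \<bar>h x\<bar> > \<tau>} \<le> ennreal ((1 + 2 * ?B) * K powr q * t0 powr q * ?L)"
  proof (cases "t \<ge> t0")
    case True
    have "ennreal (t powr q) * \<mu> {x \<in> cube_set Q. \<bar>h x\<bar> > \<tau>} \<le> ennreal (t powr q) * \<mu> (Om t)"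
      using level_set_le_Om[OF tpos] unfolding \<tau>_eq by (rule mult_left_mono) simp
    also have "\<dots> = ennreal (t powr q * measure lebesgue (Om t))"
      unfolding fin by (rule ennreal_mult[symmetric]) auto
    also have "\<dots> \<le> ennreal ((1 + 2 * ?B) * K powr q * t0 powr q * ?L)"
      using main[OF True] by (rule ennreal_leI)
    finally show ?thesis .
  next
    case False
    have "ennreal (t powr q) * \<mu> {x \<in> cube_set Q. \<bar>h x\<bar> > \<tau>} \<le> ennreal (t0 powr q) * \<mu> (cube_set Q)"
      using False tpos exps by (intro mult_mono emeasure_mono ennreal_leI powr_mono2) auto
    also have "\<dots> = ennreal (1 * (t0 powr q * ?L))"
      unfolding muQ mult_1 by (rule ennreal_mult[symmetric]) (use L in auto)
    also have "\<dots> \<le> ennreal (((1 + 2 * ?B) * K powr q) * (t0 powr q * ?L))"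
    proof (intro ennreal_leI mult_right_mono)
      have "1 * 1 \<le> (1 + 2 * ?B) * K powr q"
        using B K exps by (intro mult_mono) (auto simp: ge_one_powr_ge_zero)
      then show "1 \<le> (1 + 2 * ?B) * K powr q" by simp
    qed (use L in auto)
    finally show ?thesis by (simp add: mult_ac)
  qed
  then have "ennreal (?b powr q) * (ennreal (t powr q) * \<mu> {x \<in> cube_set Q. \<bar>h x\<bar> > \<tau>})
     \<le> ennreal (?b powr q) * ennreal ((1 + 2 * ?B) * K powr q * t0 powr q * ?L)"
    by (rule mult_left_mono) simp
  also have "ennreal (?b powr q) * (ennreal (t powr q) * \<mu> {x \<in> cube_set Q. \<bar>h x\<bar> > \<tau>})
     = ennreal (\<tau> powr q) * \<mu> {x \<in> cube_set Q. \<bar>h x\<bar> > \<tau>}"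
  proof -
    have "ennreal (\<tau> powr q) = ennreal (?b powr q) * ennreal (t powr q)"
      using tpos unfolding \<tau>_eq by (subst ennreal_mult[symmetric]) (auto simp: powr_mult)
    then show ?thesis by (simp only: mult.assoc)
  qed
  also have "ennreal (?b powr q) * ennreal ((1 + 2 * ?B) * K powr q * t0 powr q * ?L)
     = ennreal (?b powr q * (1 + 2 * ?B) * K powr q * t0 powr q) * \<mu> (cube_set Q)"
  proof -
    have "ennreal (?b powr q) * ennreal ((1 + 2 * ?B) * K powr q * t0 powr q * ?L)
      = ennreal (?b powr q * ((1 + 2 * ?B) * K powr q * t0 powr q * ?L))"
      using B L by (intro ennreal_mult[symmetric]) auto
    also have "\<dots> = ennreal ((?b powr q * (1 + 2 * ?B) * K powr q * t0 powr q) * ?L)"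
      by (simp only: mult.assoc)
    also have "\<dots> = ennreal (?b powr q * (1 + 2 * ?B) * K powr q * t0 powr q) * ennreal ?L"
      using B L by (intro ennreal_mult) auto
    finally show ?thesis by (simp only: muQ)
  qed
  finally show ?thesis .
qed

section \<open>Averages and the operators\<close>

lemma enn_root_divide_le_iff:
  assumes "p > 0" "m > 0" "T \<ge> 0"
  shows "enn_root p (I / ennreal m) \<le> ennreal T \<longleftrightarrow> I \<le> ennreal (T powr p) * ennreal m"
proof (cases I)
  case (real i)
  have "enn_root p (I / ennreal m) = ennreal ((i / m) powr (1 / p))"
    using assms real by (simp add: enn_root_def divide_ennreal)
  moreover have "(i / m) powr (1 / p) \<le> T \<longleftrightarrow> i / m \<le> T powr p"
  proof
    assume "(i / m) powr (1 / p) \<le> T"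
    then have "((i / m) powr (1 / p)) powr p \<le> T powr p"
      using assms by (intro powr_mono2) auto
    then show "i / m \<le> T powr p"
      using assms real by (simp add: powr_powr)
  next
    assume "i / m \<le> T powr p"
    then have "(i / m) powr (1 / p) \<le> (T powr p) powr (1 / p)"
      using assms real by (intro powr_mono2) auto
    then show "(i / m) powr (1 / p) \<le> T"
      using assms by (simp add: powr_powr)
  qed
  moreover have "i / m \<le> T powr p \<longleftrightarrow> i \<le> T powr p * m"
    using assms by (simp add: field_simps)
  moreover have "I \<le> ennreal (T powr p) * ennreal m \<longleftrightarrow> i \<le> T powr p * m"
    using assms real by (simp add: ennreal_mult[symmetric])
  ultimately show ?thesis
    using assms by simp
next
  case top
  then show ?thesis
    using assms by (simp add: enn_root_def ennreal_top_divide ennreal_mult[symmetric] top_unique)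
qed

lemma cube_measureE:
  fixes R :: "'n::finite cube"
  assumes "is_cube R"
  obtains m where "m > 0" "emeasure lebesgue (cube_set R) = ennreal m"
proof
  show "snd R ^ CARD('n) > 0" using assms by (simp add: is_cube_def)
  show "emeasure lebesgue (cube_set R) = ennreal (snd R ^ CARD('n))"
    using assms by (intro emeasure_cube_set) (simp add: is_cube_def)
qed

lemma Lp_avg_le_iff:
  assumes "p > 0" "is_cube R" "T \<ge> 0"
  shows "Lp_avg p (cube_set R) g \<le> ennreal T \<longleftrightarrow> avg_le p g (cube_set R) T"
proof -
  obtain m where "m > 0" "emeasure lebesgue (cube_set R) = ennreal m"
    using cube_measureE[OF assms(2)] .
  then show ?thesis
    unfolding Lp_avg_def avg_le_def using enn_root_divide_le_iff[OF assms(1) _ assms(3)] by simp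
qed

text \<open>The infimum is approached along the levels \<open>s + 1 / real (Suc n)\<close>, and
  countably many exceptional null sets still form a null set.\<close>

lemma AE_le_esssup_on:
  "AE x in lebesgue. x \<in> E \<longrightarrow> ennreal \<bar>g x\<bar> \<le> esssup_on E g"
proof (cases "esssup_on E g")
  case (real s)
  have "AE x in lebesgue. x \<in> E \<longrightarrow> ennreal \<bar>g x\<bar> \<le> ennreal (s + 1 / real (Suc n))" for n
  proof -
    have "esssup_on E g < ennreal (s + 1 / real (Suc n))"
      using real by (simp add: ennreal_less_iff del: ennreal_plus)
    then obtain t where "AE x in lebesgue. x \<in> E \<longrightarrow> ennreal \<bar>g x\<bar> \<le> t" "t < ennreal (s + 1 / real (Suc n))"
      unfolding esssup_on_def Inf_less_iff by auto
    then show ?thesis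
      by (auto elim!: eventually_mono)
  qed
  then have "AE x in lebesgue. \<forall>n. x \<in> E \<longrightarrow> ennreal \<bar>g x\<bar> \<le> ennreal (s + 1 / real (Suc n))"
    unfolding AE_all_countable by blast
  then show ?thesis
  proof eventually_elim
    case (elim x)
    show ?case
    proof
      assume "x \<in> E"
      then have *: "\<bar>g x\<bar> \<le> s + 1 / real (Suc n)" for n
        using elim real(1) by (simp add: ennreal_le_iff del: ennreal_plus)
      have "\<bar>g x\<bar> \<le> s"
      proof (rule field_le_epsilon)
        fix e :: real assume "e > 0"
        then obtain n where "inverse (real (Suc n)) < e"
          using reals_Archimedean by blast
        then show "\<bar>g x\<bar> \<le> s + e"
          using *[of n] by (simp add: inverse_eq_divide)
      qed
      then show "ennreal \<bar>g x\<bar> \<le> esssup_on E g"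
        using real by (simp add: ennreal_leI)
    qed
  qed
qed simp

text \<open>Treats finite and infinite \<open>q0\<close> alike: an essential bound also bounds the
  average with any positive exponent \<open>r\<close>.\<close>

lemma avg_norm_imp_avg_le:
  assumes R: "is_cube R" and T: "T \<ge> 0" and q0: "q0 = \<infinity> \<or> q0 = ennreal r" and r: "r > 0"
    and le: "avg_norm q0 (cube_set R) g \<le> ennreal T"
  shows "avg_le r g (cube_set R) T"
proof (cases "q0 = \<infinity>")
  case True
  then have es: "esssup_on (cube_set R) g \<le> ennreal T"
    using le by (simp add: avg_norm_def)
  have "AE x in lebesgue. x \<in> cube_set R \<longrightarrow> \<bar>g x\<bar> \<le> T"
  proof (rule eventually_mono[OF AE_le_esssup_on[of "cube_set R" g]], rule impI)
    fix x assume "x \<in> cube_set R \<longrightarrow> ennreal \<bar>g x\<bar> \<le> esssup_on (cube_set R) g" "x \<in> cube_set R"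
    then have "ennreal \<bar>g x\<bar> \<le> ennreal T"
      using es by (meson order_trans)
    then show "\<bar>g x\<bar> \<le> T" using T by simp
  qed
  then have "(\<integral>\<^sup>+x\<in>cube_set R. ennreal (\<bar>g x\<bar> powr r) \<partial>lebesgue)
      \<le> (\<integral>\<^sup>+x. ennreal (T powr r) * indicator (cube_set R) x \<partial>lebesgue)"
    by (intro nn_integral_mono_AE, eventually_elim)
      (use r in \<open>auto simp: indicator_def intro!: ennreal_leI powr_mono2\<close>)
  also have "\<dots> = ennreal (T powr r) * emeasure lebesgue (cube_set R)"
    by (simp add: nn_integral_cmult_indicator)
  finally show ?thesis by (simp add: avg_le_def)
next
  case False
  then have "q0 = ennreal r" using q0 by simp
  then have "Lp_avg r (cube_set R) g \<le> ennreal T"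
    using le r by (simp add: avg_norm_def)
  then show ?thesis
    using Lp_avg_le_iff[OF r R T] by simp
qed

section \<open>Local integrability and truncation\<close>

lemma Lp_loc_measurable: "f \<in> Lp_loc p \<Longrightarrow> f \<in> borel_measurable lebesgue"
  by (simp add: Lp_loc_def)

lemma Lp_loc_indicator:
  assumes f: "f \<in> Lp_loc p" and E: "E \<in> sets lebesgue"
  shows "(\<lambda>x. indicator E x * f x) \<in> Lp_loc p"
proof -
  have "(\<integral>\<^sup>+x\<in>K. ennreal (\<bar>indicator E x * f x\<bar> powr p) \<partial>lebesgue) < \<infinity>" if "compact K" for K
  proof -
    have "(\<integral>\<^sup>+x\<in>K. ennreal (\<bar>indicator E x * f x\<bar> powr p) \<partial>lebesgue) \<le> (\<integral>\<^sup>+x\<in>K. ennreal (\<bar>f x\<bar> powr p) \<partial>lebesgue)"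
      by (intro nn_integral_mono) (auto simp: indicator_def)
    also have "\<dots> < \<infinity>" using f that by (simp add: Lp_loc_def)
    finally show ?thesis .
  qed
  moreover have "(\<lambda>x. indicator E x * f x) \<in> borel_measurable lebesgue"
    using Lp_loc_measurable[OF f] E by measurable
  ultimately show ?thesis by (simp add: Lp_loc_def)
qed

lemma Lp_loc_cong_AE:
  assumes f: "f \<in> Lp_loc p" and g: "g \<in> borel_measurable lebesgue" and eq: "AE x in lebesgue. g x = f x"
  shows "g \<in> Lp_loc p"
proof -
  have "(\<integral>\<^sup>+x\<in>K. ennreal (\<bar>g x\<bar> powr p) \<partial>lebesgue) = (\<integral>\<^sup>+x\<in>K. ennreal (\<bar>f x\<bar> powr p) \<partial>lebesgue)" for K
    using eq by (intro nn_integral_cong_AE) (auto elim!: eventually_mono)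
  then show ?thesis using f g by (simp add: Lp_loc_def)
qed

lemma Lp_loc_diff:
  assumes f: "f \<in> Lp_loc p" and g: "g \<in> Lp_loc p" and p: "p > 0"
  shows "(\<lambda>x. f x - g x) \<in> Lp_loc p"
proof -
  note [measurable] = Lp_loc_measurable[OF f] Lp_loc_measurable[OF g]
  have pw: "\<bar>x - y\<bar> powr p \<le> 2 powr p * (\<bar>x\<bar> powr p + \<bar>y\<bar> powr p)" for x y :: real
  proof -
    have "\<bar>x - y\<bar> powr p \<le> (2 * max \<bar>x\<bar> \<bar>y\<bar>) powr p"
      using p by (intro powr_mono2) auto
    also have "\<dots> = 2 powr p * max \<bar>x\<bar> \<bar>y\<bar> powr p"
      by (simp add: powr_mult)
    also have "\<dots> \<le> 2 powr p * (\<bar>x\<bar> powr p + \<bar>y\<bar> powr p)"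
      by (intro mult_left_mono) (auto simp: max_def)
    finally show ?thesis .
  qed
  have "(\<integral>\<^sup>+x\<in>K. ennreal (\<bar>f x - g x\<bar> powr p) \<partial>lebesgue) < \<infinity>" if K: "compact K" for K
  proof -
    have Ks [measurable]: "K \<in> sets lebesgue"
      using K by (simp add: compact_imp_closed sets_completionI_sets)
    have "(\<integral>\<^sup>+x\<in>K. ennreal (\<bar>f x - g x\<bar> powr p) \<partial>lebesgue)
      \<le> (\<integral>\<^sup>+x. ennreal (2 powr p) * (ennreal (\<bar>f x\<bar> powr p) * indicator K x + ennreal (\<bar>g x\<bar> powr p) * indicator K x) \<partial>lebesgue)"
      by (intro nn_integral_mono)
        (auto simp: indicator_def ennreal_mult[symmetric] ennreal_plus[symmetric] simp del: ennreal_plus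
          intro!: ennreal_leI pw)
    also have "\<dots> = ennreal (2 powr p) * ((\<integral>\<^sup>+x\<in>K. ennreal (\<bar>f x\<bar> powr p) \<partial>lebesgue) + (\<integral>\<^sup>+x\<in>K. ennreal (\<bar>g x\<bar> powr p) \<partial>lebesgue))"
      by (simp add: nn_integral_cmult nn_integral_add)
    also have "\<dots> < \<infinity>"
      using f g K by (simp add: Lp_loc_def ennreal_mult_less_top)
    finally show ?thesis .
  qed
  then show ?thesis by (simp add: Lp_loc_def)
qed

lemma Lp_norm_finite_iff: "Lp_norm p f < \<infinity> \<longleftrightarrow> (\<integral>\<^sup>+x. ennreal (\<bar>f x\<bar> powr p) \<partial>lebesgue) < \<infinity>"
  by (auto simp: Lp_norm_def enn_root_def less_top[symmetric])

lemma Lp_norm_finite_imp_loc: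
  assumes "f \<in> borel_measurable lebesgue" "Lp_norm p f < \<infinity>"
  shows "f \<in> Lp_loc p"
proof -
  have "(\<integral>\<^sup>+x\<in>K. ennreal (\<bar>f x\<bar> powr p) \<partial>lebesgue) \<le> (\<integral>\<^sup>+x. ennreal (\<bar>f x\<bar> powr p) \<partial>lebesgue)" for K
    by (intro nn_integral_mono) (auto simp: indicator_def)
  also have "\<dots> < \<infinity>" using assms(2) by (simp only: Lp_norm_finite_iff)
  finally show ?thesis using assms(1) by (simp add: Lp_loc_def)
qed

text \<open>A half-open cube is not compact, so the comparison is with a closed ball containing
  it.\<close>

lemma Lp_norm_indicator_cube_finite:
  fixes R :: "'n::finite cube"
  assumes "f \<in> Lp_loc p"
  shows "Lp_norm p (\<lambda>x. indicator (cube_set R) x * f x) < \<infinity>"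
proof -
  let ?K = "cball (fst R) (real CARD('n) * snd R)"
  have "(\<integral>\<^sup>+x. ennreal (\<bar>indicator (cube_set R) x * f x\<bar> powr p) \<partial>lebesgue) \<le> (\<integral>\<^sup>+x\<in>?K. ennreal (\<bar>f x\<bar> powr p) \<partial>lebesgue)"
    using cube_subset_cball[of R] by (intro nn_integral_mono) (auto simp: indicator_def)
  also have "\<dots> < \<infinity>" using assms by (simp add: Lp_loc_def)
  finally show ?thesis by (simp only: Lp_norm_finite_iff)
qed

lemma weak_norm_le:
  assumes Q: "is_cube Q" and q: "q > 0" and M: "M \<ge> 0"
    and le: "\<And>\<tau>. \<tau> > 0 \<Longrightarrow> ennreal (\<tau> powr q) * emeasure lebesgue {x \<in> cube_set Q. \<tau> < \<bar>g x\<bar>}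
      \<le> ennreal (M powr q) * emeasure lebesgue (cube_set Q)"
  shows "weak_norm q (cube_set Q) g \<le> ennreal M"
  unfolding weak_norm_def
proof (rule SUP_least)
  fix \<tau> :: real assume "\<tau> \<in> {0<..}"
  then have \<tau>: "\<tau> > 0" by simp
  obtain m where m: "m > 0" "emeasure lebesgue (cube_set Q) = ennreal m"
    using cube_measureE[OF Q] .
  define L where "L = emeasure lebesgue {x \<in> cube_set Q. \<tau> < \<bar>g x\<bar>}"
  have "\<tau> powr q * (M / \<tau>) powr q = M powr q"
    using \<tau> M by (simp add: powr_divide)
  then have "ennreal (\<tau> powr q) * L \<le> ennreal (\<tau> powr q * (M / \<tau>) powr q) * ennreal m"
    using le[OF \<tau>] by (simp only: L_def m(2))
  then have "L \<le> ennreal ((M / \<tau>) powr q) * ennreal m"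
    by (rule ennreal_scale_cancel[rotated 2]) (use \<tau> in auto)
  then have "enn_root q (L / ennreal m) \<le> ennreal (M / \<tau>)"
    using q m M \<tau> by (subst enn_root_divide_le_iff) auto
  then have "ennreal \<tau> * enn_root q (L / ennreal m) \<le> ennreal \<tau> * ennreal (M / \<tau>)"
    by (rule mult_left_mono) simp
  also have "\<dots> = ennreal M"
    using M \<tau> by (simp add: ennreal_mult[symmetric])
  finally show "ennreal \<tau> * enn_root q (emeasure lebesgue {x \<in> cube_set Q. \<tau> < \<bar>g x\<bar>} / emeasure lebesgue (cube_set Q)) \<le> ennreal M"
    by (simp only: m(2) L_def)
qed

lemma avg_le_cong_AE:
  assumes "avg_le p f E T" "AE x in lebesgue. x \<in> E \<longrightarrow> g x = f x"
  shows "avg_le p g E T"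
proof -
  have "(\<integral>\<^sup>+x\<in>E. ennreal (\<bar>g x\<bar> powr p) \<partial>lebesgue) = (\<integral>\<^sup>+x\<in>E. ennreal (\<bar>f x\<bar> powr p) \<partial>lebesgue)"
    by (intro nn_integral_cong_AE eventually_mono[OF assms(2)]) (auto simp: indicator_def)
  with assms(1) show ?thesis by (simp add: avg_le_def)
qed

text \<open>Condition (c) measures its right-hand side on 4R while \<open>h\<close> is controlled on
  2R; after truncation to 2R, averaging over the larger cube only lowers the value.\<close>

lemma avg_le_indicator_superset:
  assumes "avg_le p h E T" "E \<subseteq> E'" "E' \<in> sets lebesgue"
  shows "avg_le p (\<lambda>x. indicator E x * h x) E' T"
proof -
  have "(\<integral>\<^sup>+x\<in>E'. ennreal (\<bar>indicator E x * h x\<bar> powr p) \<partial>lebesgue) = (\<integral>\<^sup>+x\<in>E. ennreal (\<bar>h x\<bar> powr p) \<partial>lebesgue)"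
    using assms(2) by (intro nn_integral_cong) (auto simp: indicator_def)
  also have "\<dots> \<le> ennreal (T powr p) * emeasure lebesgue E"
    using assms(1) by (simp add: avg_le_def)
  also have "\<dots> \<le> ennreal (T powr p) * emeasure lebesgue E'"
    using assms(2,3) by (intro mult_left_mono emeasure_mono) auto
  finally show ?thesis by (simp add: avg_le_def)
qed

text \<open>Uniformity lies in the order of quantifiers: the constant is chosen before the function,
  the functional and the cube, once the D_q constant \<open>CD\<close> is fixed. Operators act on
  representatives, so their identities hold almost everywhere.\<close>

theorem mainTheorem5:
  fixes p0 q :: real and q0 :: ennreal
    and B :: "'n::finite cube \<Rightarrow> (real^'n \<Rightarrow> real) \<Rightarrow> (real^'n \<Rightarrow> real)"
    and Cp0 :: real and \<alpha> :: "nat \<Rightarrow> real"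
  assumes exps: "1 \<le> p0" "p0 < q" "ennreal q < q0"
    (* each B_Q is a linear operator on L^{p0}_loc *)
    and B_meas: "\<And>Q f. is_cube Q \<Longrightarrow> f \<in> Lp_loc p0 \<Longrightarrow> B Q f \<in> borel_measurable lebesgue"
    and B_wd: "\<And>Q f g. is_cube Q \<Longrightarrow> f \<in> Lp_loc p0 \<Longrightarrow> g \<in> Lp_loc p0 \<Longrightarrow>
               (AE x in lebesgue. f x = g x) \<Longrightarrow> (AE x in lebesgue. B Q f x = B Q g x)"
    and B_lin: "\<And>Q f g c. is_cube Q \<Longrightarrow> f \<in> Lp_loc p0 \<Longrightarrow> g \<in> Lp_loc p0 \<Longrightarrow>
               (AE x in lebesgue. B Q (\<lambda>y. c * f y + g y) x = c * B Q f x + B Q g x)"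
    (* condition (b) *)
    and cond_b: "\<And>Q f. is_cube Q \<Longrightarrow> f \<in> Lp_loc p0 \<Longrightarrow> Lp_norm p0 f < \<infinity> \<Longrightarrow>
               Lp_norm p0 (B Q f) \<le> ennreal Cp0 * Lp_norm p0 f"
    (* condition (c) *)
    and alpha_nonneg: "\<And>k. k \<ge> 2 \<Longrightarrow> \<alpha> k \<ge> 0"
    and alpha_sum: "summable (\<lambda>k. 2 powr (real k * real CARD('n) / p0) * \<alpha> k)"
    and cond_c1: "\<And>Q f. is_cube Q \<Longrightarrow> f \<in> Lp_loc p0 \<Longrightarrow>
               avg_norm q0 (cube_set (scale_cube 2 Q))
                  (A_op B Q (\<lambda>x. indicator (cube_set (scale_cube 4 Q)) x * f x))
               \<le> ennreal (\<alpha> 2) * Lp_avg p0 (cube_set (scale_cube 4 Q)) f"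
    and cond_c2: "\<And>Q f j. is_cube Q \<Longrightarrow> f \<in> Lp_loc p0 \<Longrightarrow> j \<ge> 1 \<Longrightarrow>
               avg_norm q0 (cube_set (scale_cube (2 ^ j) Q))
                  (A_op B Q (\<lambda>x. indicator (UNIV - cube_set (scale_cube (2 ^ (j + 1)) Q)) x * f x))
               \<le> (\<Sum>k. ennreal (\<alpha> (k + 2 + j)) *
                      Lp_avg p0 (cube_set (scale_cube (2 ^ (k + 2 + j)) Q)) f)"
    (* A_R A_Q f = A_Q f a.e. on 2R for cubes R \<subseteq> Q *)
    and AA: "\<And>R Q f. is_cube R \<Longrightarrow> is_cube Q \<Longrightarrow> cube_set R \<subseteq> cube_set Q \<Longrightarrow>
               f \<in> Lp_loc p0 \<Longrightarrow>
               AE x in lebesgue. x \<in> cube_set (scale_cube 2 R) \<longrightarrow>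
                  A_op B R (A_op B Q f) x = A_op B Q f x"
    (* locality of A_Q *)
    and local: "\<And>Q f. is_cube Q \<Longrightarrow> f \<in> Lp_loc p0 \<Longrightarrow>
               AE x in lebesgue. A_op B Q f x =
                  indicator (cube_set (scale_cube 2 Q)) x *
                  A_op B Q (\<lambda>y. indicator (cube_set (scale_cube 2 Q)) y * f y) x"
    and CD: "CD \<ge> 1"
  shows "\<exists>C. \<forall>f a. f \<in> Lp_loc p0 \<longrightarrow> (\<forall>Q. is_cube Q \<longrightarrow> a Q \<ge> 0) \<longrightarrow> Dq_const q CD a \<longrightarrow>
           (\<forall>Q. is_cube Q \<longrightarrow> Lp_avg p0 (cube_set (scale_cube 2 Q)) (B Q f) \<le> ennreal (a (scale_cube 2 Q))) \<longrightarrow>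
           (\<forall>Q. is_cube Q \<longrightarrow> weak_norm q (cube_set Q) (B Q f) \<le> ennreal (C * a (scale_cube 2 Q)))"
proof -

  \<comment> \<open>Choice of the exponent and of the constants\<close>
  define r where "r = (if q0 = \<infinity> then q + 1 else enn2real q0)"
  have p0: "p0 > 0" and q: "q > 0" using exps by auto
  have q0r: "q0 = \<infinity> \<or> q0 = ennreal r"
    by (auto simp: r_def less_top)
  have qr: "q < r"
  proof (cases "q0 = \<infinity>")
    case False
    then have "ennreal q < ennreal r" using q0r exps(3) by simp
    then show ?thesis using q by (simp add: ennreal_less_iff)
  qed (simp add: r_def)
  have a2: "\<alpha> 2 \<ge> 0" by (rule alpha_nonneg) simp
  let ?V = "vitali_const TYPE('n)" and ?N = "real CARD('n)"
  have A0: "2 * ?V * 2 ^ CARD('n) * 2 powr p0 \<ge> 0"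
    using vitali_const_pos[where 'n='n] by simp
  have b0: "4 powr (r - p0) * (\<alpha> 2 * 2 powr (?N / p0)) powr r \<ge> 0" by simp
  \<comment> \<open>Both depend only on the dimension, the exponents and \<open>\<alpha> 2\<close>,
    so they serve all functions, functionals and cubes.\<close>
  obtain K \<gamma> where K: "K > 1" and \<gamma>: "\<gamma> > 0" and small:
    "2 * ?V * 2 ^ CARD('n) * 2 powr p0 * (4 powr (r - p0) * (\<alpha> 2 * 2 powr (?N / p0)) powr r * K powr (- r) + (\<gamma> / K) powr p0) * K powr q \<le> 1 / 2"
    using exists_good_lambda_params[OF exps(1,2) qr A0 b0] .
  define Cq where "Cq = (2 powr (?N / p0)) powr q * (1 + 2 * (?V * CD powr q * 2 ^ CARD('n) / \<gamma> powr q)) * K powr q"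
  \<comment> \<open>\<open>Cq\<close> is the constant of \<open>distribution_bound\<close> without
    \<open>t0 powr q\<close>; its \<open>q\<close>-th root is what the weak norm sees.\<close>
  define C where "C = Cq powr (1 / q)"
  have Cq: "Cq \<ge> 0" using vitali_const_pos[where 'n='n] by (simp add: Cq_def)
  have C: "C \<ge> 0" by (simp add: C_def)

  \<comment> \<open>The operators preserve local integrability\<close>
  have B_loc: "B Q f \<in> Lp_loc p0" and A_loc: "A_op B Q f \<in> Lp_loc p0" if Q: "is_cube Q" and f: "f \<in> Lp_loc p0" for Q f
  proof -
    let ?I = "cube_set (scale_cube 2 Q)"
    \<comment> \<open>By locality only the truncation to 2Q matters for A_Q f, and it has finite
      global norm, so condition (b) applies to it.\<close>
    let ?\<phi> = "\<lambda>y. indicator ?I y * f y"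
    have \<phi>: "?\<phi> \<in> Lp_loc p0" by (intro Lp_loc_indicator f) simp
    have \<phi>n: "Lp_norm p0 ?\<phi> < \<infinity>" by (rule Lp_norm_indicator_cube_finite[OF f])
    have "Lp_norm p0 (B Q ?\<phi>) < \<infinity>"
      using cond_b[OF Q \<phi> \<phi>n] \<phi>n by (auto intro: le_less_trans simp: ennreal_mult_less_top)
    then have "B Q ?\<phi> \<in> Lp_loc p0"
      by (intro Lp_norm_finite_imp_loc B_meas Q \<phi>)
    then have "A_op B Q ?\<phi> \<in> Lp_loc p0"
      unfolding A_op_def by (intro Lp_loc_diff \<phi> p0)
    then have "(\<lambda>x. indicator ?I x * A_op B Q ?\<phi> x) \<in> Lp_loc p0"
      by (rule Lp_loc_indicator) simp
    moreover have "A_op B Q f \<in> borel_measurable lebesgue"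
      unfolding A_op_def using Lp_loc_measurable[OF f] B_meas[OF Q f] by simp
    ultimately show A: "A_op B Q f \<in> Lp_loc p0"
      using local[OF Q f] by (rule Lp_loc_cong_AE)
    have "B Q f = (\<lambda>x. f x - A_op B Q f x)" by (simp add: A_op_def)
    then show "B Q f \<in> Lp_loc p0"
      using Lp_loc_diff[OF f A p0] by simp
  qed

  \<comment> \<open>The estimate at a positive height dominating a(2Q)\<close>
  have bound: "weak_norm q (cube_set Q) (B Q f) \<le> ennreal (C * t0)"
    if f: "f \<in> Lp_loc p0" and a: "\<And>Q. is_cube Q \<Longrightarrow> a Q \<ge> 0" and Dq: "Dq_const q CD a"
      and avg: "\<And>Q. is_cube Q \<Longrightarrow> Lp_avg p0 (cube_set (scale_cube 2 Q)) (B Q f) \<le> ennreal (a (scale_cube 2 Q))"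
      and Q: "is_cube Q" and t0: "t0 > 0" "a (scale_cube 2 Q) \<le> t0" for f a Q t0
  proof -
    have vb: "avg_le p0 (B R f) (cube_set (scale_cube 2 R)) (a (scale_cube 2 R))" if "is_cube R" for R
      using avg[OF that] a[of "scale_cube 2 R"] that p0 by (simp add: Lp_avg_le_iff)
    let ?h = "B Q f"
    have h: "?h \<in> Lp_loc p0" by (rule B_loc[OF Q f])
    interpret good_lambda Q ?h "\<lambda>R. A_op B R ?h" "\<lambda>R. B R f" a p0 q r "\<alpha> 2" CD t0
    proof
      show "A_op B R ?h \<in> borel_measurable lebesgue" if "is_cube R" for R
        by (rule Lp_loc_measurable[OF A_loc[OF that h]])
    next
      fix R :: "'n cube" assume R: "is_cube R" "cube_set R \<subseteq> cube_set Q"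
      \<comment> \<open>Writing h = f - A_Q f gives B_R h = B_R f - B_R A_Q f. The identity A_R A_Q
        f = A_Q f says that the last term vanishes on 2R, so h = A_R h + B_R f there.\<close>
      have "AE x in lebesgue. B R (\<lambda>y. - 1 * A_op B Q f y + f y) x = - 1 * B R (A_op B Q f) x + B R f x"
        by (rule B_lin[OF R(1) A_loc[OF Q f] f])
      moreover have "(\<lambda>y. - 1 * A_op B Q f y + f y) = ?h" by (simp add: A_op_def)
      ultimately have lin: "AE x in lebesgue. B R ?h x = - B R (A_op B Q f) x + B R f x" by simp
      show "AE x in lebesgue. x \<in> cube_set (scale_cube 2 R) \<longrightarrow> ?h x = A_op B R ?h x + B R f x"
        using lin AA[OF R(1) Q R(2) f]
        by eventually_elim (auto simp: A_op_def)
    next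
      fix R :: "'n cube" and T :: real
      assume R: "is_cube R" "cube_set R \<subseteq> cube_set Q" and T: "T \<ge> 0"
        and le: "avg_le p0 ?h (cube_set (scale_cube 2 R)) T"
      let ?I = "cube_set (scale_cube 2 R)" and ?J = "cube_set (scale_cube 4 R)"
      \<comment> \<open>Locality replaces \<open>h\<close> by its truncation to 2R. Cutting it off
        at 4R changes nothing, so the first inequality of condition (c) applies with an average of
        at most \<open>T\<close>.\<close>
      let ?\<psi> = "\<lambda>y. indicator ?I y * ?h y"
      have \<psi>: "?\<psi> \<in> Lp_loc p0" by (intro Lp_loc_indicator h) simp
      have IJ: "?I \<subseteq> ?J" using R(1) by (intro scale_cube_incr) auto
      have "Lp_avg p0 ?J ?\<psi> \<le> ennreal T"
        using avg_le_indicator_superset[OF le IJ] R(1) T p0 by (subst Lp_avg_le_iff) auto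
      have "(\<lambda>x. indicator ?J x * ?\<psi> x) = ?\<psi>"
        using IJ by (auto simp: indicator_def fun_eq_iff)
      then have "avg_norm q0 ?I (A_op B R ?\<psi>) \<le> ennreal (\<alpha> 2) * Lp_avg p0 ?J ?\<psi>"
        using cond_c1[OF R(1) \<psi>] by simp
      also have "\<dots> \<le> ennreal (\<alpha> 2) * ennreal T"
        by (rule mult_left_mono) (fact, simp)
      also have "\<dots> = ennreal (\<alpha> 2 * T)"
        using a2 T by (simp add: ennreal_mult)
      finally have "avg_le r (A_op B R ?\<psi>) ?I (\<alpha> 2 * T)"
        using R(1) a2 T q0r qr q by (intro avg_norm_imp_avg_le) auto
      moreover have "AE x in lebesgue. x \<in> ?I \<longrightarrow> A_op B R ?h x = A_op B R ?\<psi> x"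
        using local[OF R(1) h] by eventually_elim simp
      ultimately show "avg_le r (A_op B R ?h) ?I (\<alpha> 2 * T)"
        by (rule avg_le_cong_AE)
    next
      show "avg_le p0 ?h (cube_set (scale_cube 2 Q)) t0"
        by (rule avg_le_mono[OF vb[OF Q]]) (use t0 a[of "scale_cube 2 Q"] Q p0 in auto)
    next
      show "is_cube Q" "?h \<in> borel_measurable lebesgue" "1 \<le> p0" "p0 < q" "q < r" "0 \<le> \<alpha> 2" "0 < t0"
        "Dq_const q CD a" "a (scale_cube 2 Q) \<le> t0"
        by (fact Q exps qr a2 t0 Dq Lp_loc_measurable[OF h])+
    next
      show "B R f \<in> borel_measurable lebesgue" "0 \<le> a R"
        "avg_le p0 (B R f) (cube_set (scale_cube 2 R)) (a (scale_cube 2 R))" if "is_cube R" for R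
        using B_meas[OF that f] a[OF that] vb[OF that] .
    qed
    show ?thesis
    proof (rule weak_norm_le[OF Q q])
      show "C * t0 \<ge> 0" using C t0 by simp
    next
      fix \<tau> :: real assume "\<tau> > 0"
      have "(C * t0) powr q = Cq * t0 powr q"
        using C Cq t0 q by (simp add: powr_mult C_def powr_powr)
      then show "ennreal (\<tau> powr q) * emeasure lebesgue {x \<in> cube_set Q. \<tau> < \<bar>?h x\<bar>}
        \<le> ennreal ((C * t0) powr q) * emeasure lebesgue (cube_set Q)"
        using distribution_bound[OF K \<gamma> \<open>\<tau> > 0\<close> small] by (simp only: Cq_def)
    qed
  qed

  \<comment> \<open>The choice of height, including vanishing a(2Q)\<close>
  have "weak_norm q (cube_set Q) (B Q f) \<le> ennreal (C * a (scale_cube 2 Q))"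
    if f: "f \<in> Lp_loc p0" and a: "\<And>Q. is_cube Q \<Longrightarrow> a Q \<ge> 0" and Dq: "Dq_const q CD a"
      and avg: "\<And>Q. is_cube Q \<Longrightarrow> Lp_avg p0 (cube_set (scale_cube 2 Q)) (B Q f) \<le> ennreal (a (scale_cube 2 Q))"
      and Q: "is_cube Q" for f a Q
  proof (cases "a (scale_cube 2 Q) = 0")
    case False
    then show ?thesis
      using bound[OF f a Dq avg Q, of "a (scale_cube 2 Q)"] a[of "scale_cube 2 Q"] Q by auto
  next
    case True
    show ?thesis
    \<comment> \<open>The height must be positive, so arbitrarily small ones are used;
      \<open>e / (C + 1)\<close> turns the bound into at most \<open>e\<close> even when
      \<open>C = 0\<close>.\<close>
    proof (rule ennreal_le_epsilon)
      fix e :: real assume e: "e > 0"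
      have "weak_norm q (cube_set Q) (B Q f) \<le> ennreal (C * (e / (C + 1)))"
        using True e C by (intro bound[OF f a Dq avg Q]) auto
      also have "C * (e / (C + 1)) \<le> e"
        using C e by (simp add: field_simps)
      finally show "weak_norm q (cube_set Q) (B Q f) \<le> ennreal (C * a (scale_cube 2 Q)) + ennreal e"
        using True by (simp add: ennreal_leI)
    qed
  qed
  then show ?thesis by blast
qed

end
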